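(* If $A\,|\,B$ is a split D2 extension of rings, then $A_B$ and ${}_BA$ are finitely generated projective modules.
   Context: Rings are associative and unital; a ring extension $A\,|\,B$ means a ring $A$ with a subring $B$ containing $1_A$. $A\,|\,B$ is split if the inclusion $B\to A$ is a split monomorphism of $B$-$B$-bimodules. $A\,|\,B$ is D2 (depth two) if it is left D2 and right D2, i.e. $A\otimes_BA$ is isomorphic to a direct summand of a finite direct sum of copies of the natural bimodule $A$, both as $B$-$A$-bimodules (left D2) and as $A$-$B$-bimodules (right D2). *)

theory Defs
  imports "HOL-Algebra.Free_Abelian_Groups" "HOL-Algebra.Generated_Groups" "HOL-Algebra.Subrings"
begin

text \<open>
  The library's \<^locale>\<open>module\<close> requires a commutative base ring, so one- and two-sided modules over
  arbitrary rings are introduced here. Left modules use the library record (with left action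
  \<^const>\<open>smult\<close>), to which a second field adds a right action. The one-sided notions below read only
  the action they are about. The fields \<open>mult\<close> and \<open>one\<close>, which the library's module record
  inherits from \<open>ring\<close>, have no meaning for a module.
\<close>

record ('l, 'r, 'm) bimodule = "('l, 'm) module" +
  rsmult :: "'m \<Rightarrow> 'r \<Rightarrow> 'm"

locale left_module = R?: ring R + M?: abelian_group M
  for R :: "('l, 'a) ring_scheme" (structure) and M :: "('l, 'm, 'b) module_scheme" (structure) +
  assumes smult_closed: "\<lbrakk>r \<in> carrier R; x \<in> carrier M\<rbrakk> \<Longrightarrow> smult M r x \<in> carrier M"
    and smult_add_left: "\<lbrakk>r \<in> carrier R; s \<in> carrier R; x \<in> carrier M\<rbrakk> \<Longrightarrow>
      smult M (r \<oplus>\<^bsub>R\<^esub> s) x = smult M r x \<oplus>\<^bsub>M\<^esub> smult M s x"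
    and smult_add_right: "\<lbrakk>r \<in> carrier R; x \<in> carrier M; y \<in> carrier M\<rbrakk> \<Longrightarrow>
      smult M r (x \<oplus>\<^bsub>M\<^esub> y) = smult M r x \<oplus>\<^bsub>M\<^esub> smult M r y"
    and smult_assoc: "\<lbrakk>r \<in> carrier R; s \<in> carrier R; x \<in> carrier M\<rbrakk> \<Longrightarrow>
      smult M (r \<otimes>\<^bsub>R\<^esub> s) x = smult M r (smult M s x)"
    and smult_one: "x \<in> carrier M \<Longrightarrow> smult M \<one>\<^bsub>R\<^esub> x = x"

locale right_module = S?: ring S + M?: abelian_group M
  for S :: "('r, 'a) ring_scheme" (structure) and M :: "('l, 'r, 'm, 'b) bimodule_scheme" (structure) +
  assumes rsmult_closed: "\<lbrakk>x \<in> carrier M; r \<in> carrier S\<rbrakk> \<Longrightarrow> rsmult M x r \<in> carrier M"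
    and rsmult_add_right: "\<lbrakk>x \<in> carrier M; r \<in> carrier S; s \<in> carrier S\<rbrakk> \<Longrightarrow>
      rsmult M x (r \<oplus>\<^bsub>S\<^esub> s) = rsmult M x r \<oplus>\<^bsub>M\<^esub> rsmult M x s"
    and rsmult_add_left: "\<lbrakk>x \<in> carrier M; y \<in> carrier M; r \<in> carrier S\<rbrakk> \<Longrightarrow>
      rsmult M (x \<oplus>\<^bsub>M\<^esub> y) r = rsmult M x r \<oplus>\<^bsub>M\<^esub> rsmult M y r"
    and rsmult_assoc: "\<lbrakk>x \<in> carrier M; r \<in> carrier S; s \<in> carrier S\<rbrakk> \<Longrightarrow>
      rsmult M x (r \<otimes>\<^bsub>S\<^esub> s) = rsmult M (rsmult M x r) s"
    and rsmult_one: "x \<in> carrier M \<Longrightarrow> rsmult M x \<one>\<^bsub>S\<^esub> = x"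

definition left_lin ::
    "('l, 'a) ring_scheme \<Rightarrow> ('l, 'm, 'b) module_scheme \<Rightarrow> ('l, 'n, 'c) module_scheme \<Rightarrow> ('m \<Rightarrow> 'n) set"
  where "left_lin R M N = {f \<in> hom (add_monoid M) (add_monoid N).
    \<forall>r\<in>carrier R. \<forall>x\<in>carrier M. f (smult M r x) = smult N r (f x)}"

definition right_lin ::
    "('r, 'a) ring_scheme \<Rightarrow> ('l, 'r, 'm, 'b) bimodule_scheme \<Rightarrow> ('k, 'r, 'n, 'c) bimodule_scheme
      \<Rightarrow> ('m \<Rightarrow> 'n) set"
  where "right_lin S M N = {f \<in> hom (add_monoid M) (add_monoid N).
    \<forall>r\<in>carrier S. \<forall>x\<in>carrier M. f (rsmult M x r) = rsmult N (f x) r}"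

definition bimod_hom ::
    "('l, 'a) ring_scheme \<Rightarrow> ('r, 'b) ring_scheme \<Rightarrow> ('l, 'r, 'm, 'c) bimodule_scheme
      \<Rightarrow> ('l, 'r, 'n, 'd) bimodule_scheme \<Rightarrow> ('m \<Rightarrow> 'n) set"
  where "bimod_hom R S M N = left_lin R M N \<inter> right_lin S M N"

definition sub_bimodule ::
    "('l, 'a) ring_scheme \<Rightarrow> ('r, 'b) ring_scheme \<Rightarrow> ('l, 'r, 'm, 'c) bimodule_scheme \<Rightarrow> 'm set \<Rightarrow> bool"
  where "sub_bimodule R S M P \<longleftrightarrow> subgroup P (add_monoid M) \<and>
    (\<forall>r\<in>carrier R. \<forall>x\<in>P. smult M r x \<in> P) \<and> (\<forall>s\<in>carrier S. \<forall>x\<in>P. rsmult M x s \<in> P)"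

definition direct_summand ::
    "('l, 'a) ring_scheme \<Rightarrow> ('r, 'b) ring_scheme \<Rightarrow> ('l, 'r, 'm, 'c) bimodule_scheme \<Rightarrow> 'm set \<Rightarrow> bool"
  where "direct_summand R S M P \<longleftrightarrow> sub_bimodule R S M P \<and>
    (\<exists>Q. sub_bimodule R S M Q \<and> P <+>\<^bsub>M\<^esub> Q = carrier M \<and> P \<inter> Q = {\<zero>\<^bsub>M\<^esub>})"

definition iso_to_direct_summand ::
    "('l, 'a) ring_scheme \<Rightarrow> ('r, 'b) ring_scheme \<Rightarrow> ('l, 'r, 'm, 'c) bimodule_scheme
      \<Rightarrow> ('l, 'r, 'n, 'd) bimodule_scheme \<Rightarrow> bool"
  where "iso_to_direct_summand R S M N \<longleftrightarrow>
    (\<exists>P. direct_summand R S N P \<and>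
      (\<exists>f \<in> bimod_hom R S M (N\<lparr>carrier := P\<rparr>). bij_betw f (carrier M) P))"

text \<open>The direct sum of \<open>n\<close> copies of \<open>M\<close>, as extensional functions on \<open>{..<n}\<close>.\<close>

definition direct_power ::
    "nat \<Rightarrow> ('l, 'r, 'm, 'a) bimodule_scheme \<Rightarrow> ('l, 'r, nat \<Rightarrow> 'm) bimodule"
  where "direct_power n M =
    \<lparr>carrier = {..<n} \<rightarrow>\<^sub>E carrier M,
     mult = undefined,
     one = undefined,
     zero = (\<lambda>i\<in>{..<n}. \<zero>\<^bsub>M\<^esub>),
     add = (\<lambda>f g. \<lambda>i\<in>{..<n}. f i \<oplus>\<^bsub>M\<^esub> g i),
     smult = (\<lambda>r f. \<lambda>i\<in>{..<n}. smult M r (f i)),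
     rsmult = (\<lambda>f s. \<lambda>i\<in>{..<n}. rsmult M (f i) s)\<rparr>"

text \<open>
  The ring \<open>A\<close> acting on itself by multiplication. It does not record the acting rings, so it also
  serves as \<open>A\<close> regarded as a module over a subring on either side.
\<close>

definition natural_bimodule :: "('a, 'b) ring_scheme \<Rightarrow> ('a, 'a, 'a) bimodule"
  where "natural_bimodule A =
    \<lparr>carrier = carrier A, mult = mult A, one = one A, zero = zero A, add = add A,
     smult = mult A, rsmult = mult A\<rparr>"

text \<open>
  The tensor product of a right \<open>R\<close>-module \<open>M\<close> and a left \<open>R\<close>-module \<open>N\<close>: the free abelian group on
  \<open>carrier M \<times> carrier N\<close> modulo the subgroup generated by the usual relations. The generator
  \<open>frag_of (x, y)\<close> represents \<open>x \<otimes> y\<close>.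
\<close>

definition tensor_relations ::
    "('r, 'a) ring_scheme \<Rightarrow> ('l, 'r, 'm, 'b) bimodule_scheme \<Rightarrow> ('r, 's, 'n, 'c) bimodule_scheme
      \<Rightarrow> ('m \<times> 'n \<Rightarrow>\<^sub>0 int) set"
  where "tensor_relations R M N =
    {frag_of (x \<oplus>\<^bsub>M\<^esub> x', y) - frag_of (x, y) - frag_of (x', y) | x x' y.
       x \<in> carrier M \<and> x' \<in> carrier M \<and> y \<in> carrier N} \<union>
    {frag_of (x, y \<oplus>\<^bsub>N\<^esub> y') - frag_of (x, y) - frag_of (x, y') | x y y'.
       x \<in> carrier M \<and> y \<in> carrier N \<and> y' \<in> carrier N} \<union>
    {frag_of (rsmult M x r, y) - frag_of (x, smult N r y) | x r y.
       x \<in> carrier M \<and> r \<in> carrier R \<and> y \<in> carrier N}"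

definition tensor_kernel ::
    "('r, 'a) ring_scheme \<Rightarrow> ('l, 'r, 'm, 'b) bimodule_scheme \<Rightarrow> ('r, 's, 'n, 'c) bimodule_scheme
      \<Rightarrow> ('m \<times> 'n \<Rightarrow>\<^sub>0 int) set"
  where "tensor_kernel R M N =
    generate (free_Abelian_group (carrier M \<times> carrier N)) (tensor_relations R M N)"

text \<open>
  The actions \<open>l (x \<otimes> y) = (l x) \<otimes> y\<close> and \<open>(x \<otimes> y) s = x \<otimes> (y s)\<close> are computed on a coset by applying
  the induced endomorphism of the free group to its elements and saturating the image with the kernel
  (the image itself need not be a full coset).
\<close>

definition tensor ::
    "('r, 'a) ring_scheme \<Rightarrow> ('l, 'r, 'm, 'b) bimodule_scheme \<Rightarrow> ('r, 's, 'n, 'c) bimodule_scheme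
      \<Rightarrow> ('l, 's, ('m \<times> 'n \<Rightarrow>\<^sub>0 int) set) bimodule"
  where "tensor R M N =
    (let F = free_Abelian_group (carrier M \<times> carrier N); K = tensor_kernel R M N in
    \<lparr>carrier = carrier (F Mod K),
     mult = undefined,
     one = undefined,
     zero = one (F Mod K),
     add = mult (F Mod K),
     smult = (\<lambda>l C. K <#>\<^bsub>F\<^esub> frag_extend (\<lambda>(x, y). frag_of (smult M l x, y)) ` C),
     rsmult = (\<lambda>C s. K <#>\<^bsub>F\<^esub> frag_extend (\<lambda>(x, y). frag_of (x, rsmult N y s)) ` C)\<rparr>)"

text \<open>A ring extension \<open>A | B\<close>; \<^locale>\<open>subring\<close> includes \<open>\<one>\<^bsub>A\<^esub> \<in> B\<close>.\<close>

locale ring_extension = ring A + base: subring B A for A (structure) and B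

abbreviation base_ring :: "('a, 'b) ring_scheme \<Rightarrow> 'a set \<Rightarrow> ('a, 'b) ring_scheme"
  where "base_ring A B \<equiv> A\<lparr>carrier := B\<rparr>"

definition split_bimod_mono ::
    "('l, 'a) ring_scheme \<Rightarrow> ('r, 'b) ring_scheme \<Rightarrow> ('l, 'r, 'm, 'c) bimodule_scheme
      \<Rightarrow> ('l, 'r, 'n, 'd) bimodule_scheme \<Rightarrow> ('m \<Rightarrow> 'n) \<Rightarrow> bool"
  where "split_bimod_mono R S M N i \<longleftrightarrow> i \<in> bimod_hom R S M N \<and>
    (\<exists>p \<in> bimod_hom R S N M. \<forall>x\<in>carrier M. p (i x) = x)"

definition split_extension :: "('a, 'b) ring_scheme \<Rightarrow> 'a set \<Rightarrow> bool"
  where "split_extension A B \<longleftrightarrow>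
    split_bimod_mono (base_ring A B) (base_ring A B)
      (natural_bimodule (base_ring A B)) (natural_bimodule A) (\<lambda>b. b)"

abbreviation tensor_square :: "('a, 'b) ring_scheme \<Rightarrow> 'a set \<Rightarrow> ('a, 'a, ('a \<times> 'a \<Rightarrow>\<^sub>0 int) set) bimodule"
  where "tensor_square A B \<equiv> tensor (base_ring A B) (natural_bimodule A) (natural_bimodule A)"

definition left_D2 :: "('a, 'b) ring_scheme \<Rightarrow> 'a set \<Rightarrow> bool"
  where "left_D2 A B \<longleftrightarrow>
    (\<exists>n. iso_to_direct_summand (base_ring A B) A (tensor_square A B) (direct_power n (natural_bimodule A)))"

definition right_D2 :: "('a, 'b) ring_scheme \<Rightarrow> 'a set \<Rightarrow> bool"
  where "right_D2 A B \<longleftrightarrow>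
    (\<exists>n. iso_to_direct_summand A (base_ring A B) (tensor_square A B) (direct_power n (natural_bimodule A)))"

definition D2 :: "('a, 'b) ring_scheme \<Rightarrow> 'a set \<Rightarrow> bool"
  where "D2 A B \<longleftrightarrow> left_D2 A B \<and> right_D2 A B"

definition finitely_generated_left :: "('l, 'a) ring_scheme \<Rightarrow> ('l, 'm, 'b) module_scheme \<Rightarrow> bool"
  where "finitely_generated_left R M \<longleftrightarrow>
    (\<exists>X. finite X \<and> X \<subseteq> carrier M \<and>
      (\<forall>m\<in>carrier M. \<exists>c \<in> X \<rightarrow> carrier R. m = (\<Oplus>\<^bsub>M\<^esub>x\<in>X. smult M (c x) x)))"

definition finitely_generated_right ::
    "('r, 'a) ring_scheme \<Rightarrow> ('l, 'r, 'm, 'b) bimodule_scheme \<Rightarrow> bool"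
  where "finitely_generated_right S M \<longleftrightarrow>
    (\<exists>X. finite X \<and> X \<subseteq> carrier M \<and>
      (\<forall>m\<in>carrier M. \<exists>c \<in> X \<rightarrow> carrier S. m = (\<Oplus>\<^bsub>M\<^esub>x\<in>X. rsmult M x (c x))))"

text \<open>
  \<open>P\<close> is projective if every homomorphism from \<open>P\<close> to \<open>N\<close> lifts along every surjective homomorphism
  from \<open>M\<close> to \<open>N\<close>. HOL cannot quantify over types inside a definition, so the element types of \<open>M\<close>
  and \<open>N\<close> are parameters; a theorem concluding projectivity for arbitrary type variables \<open>'m\<close>, \<open>'n\<close>
  gives the lifting property against all modules. Right modules \<open>M\<close>, \<open>N\<close> have a left action
  field of domain \<^typ>\<open>unit\<close>, which is ignored.
\<close>

definition projective_left ::
    "'m itself \<Rightarrow> 'n itself \<Rightarrow> ('l, 'a) ring_scheme \<Rightarrow> ('l, 'p, 'b) module_scheme \<Rightarrow> bool"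
  where "projective_left _ _ R P \<longleftrightarrow> left_module R P \<and>
    (\<forall>(M :: ('l, 'm) module) (N :: ('l, 'n) module) g f.
      left_module R M \<and> left_module R N \<and>
      g \<in> left_lin R M N \<and> g ` carrier M = carrier N \<and> f \<in> left_lin R P N \<longrightarrow>
      (\<exists>h \<in> left_lin R P M. \<forall>x\<in>carrier P. g (h x) = f x))"

definition projective_right ::
    "'m itself \<Rightarrow> 'n itself \<Rightarrow> ('r, 'a) ring_scheme \<Rightarrow> ('l, 'r, 'p, 'b) bimodule_scheme \<Rightarrow> bool"
  where "projective_right _ _ S P \<longleftrightarrow> right_module S P \<and>
    (\<forall>(M :: (unit, 'r, 'm) bimodule) (N :: (unit, 'r, 'n) bimodule) g f.
      right_module S M \<and> right_module S N \<and>
      g \<in> right_lin S M N \<and> g ` carrier M = carrier N \<and> f \<in> right_lin S P N \<longrightarrow>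
      (\<exists>h \<in> right_lin S P M. \<forall>x\<in>carrier P. g (h x) = f x))"

end

theory Submission
  imports Defs
begin

text \<open>
  Let \<open>p\<close> from \<open>A\<close> to \<open>B\<close> be a \<open>B\<close>-bimodule map with \<open>p(1) = 1\<close>, which the splitting provides. Right
  depth two says in particular that the left \<open>A\<close>-module \<open>A \<otimes>\<^sub>B A\<close> is a direct summand of some \<open>A\<^sup>n\<close>, so
  there are elements \<open>t\<^sub>i\<close> of \<open>A \<otimes>\<^sub>B A\<close> and \<open>A\<close>-linear forms \<open>f\<^sub>i\<close> with \<open>t = \<Sum>\<^sub>i f\<^sub>i(t) t\<^sub>i\<close> for all \<open>t\<close>.
  Write \<open>t\<^sub>i = \<Sum>\<^sub>j x\<^sub>i\<^sub>j \<otimes> y\<^sub>i\<^sub>j\<close>, take \<open>t = 1 \<otimes> y\<close>, and apply the additive map \<open>x \<otimes> y \<mapsto> p(x) y\<close>. The result is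
  \<open>y = \<Sum>\<^sub>i\<^sub>j p(f\<^sub>i(1 \<otimes> y) x\<^sub>i\<^sub>j) y\<^sub>i\<^sub>j\<close>, in which the coefficients are left \<open>B\<close>-linear in \<open>y\<close> with values in
  \<open>B\<close>. This is a finite dual basis of \<open>A\<close> as a left \<open>B\<close>-module, so that module is finitely generated
  projective. Left depth two gives \<open>A\<close> as a right \<open>B\<close>-module in the same way, from \<open>t = x \<otimes> 1\<close> and the
  map \<open>x \<otimes> y \<mapsto> x p(y)\<close>.

  The existence of a finite dual basis is expressed by saying that the identity is a finite-rank map.
  Its consequences are \<open>finite_rank_imp_spanned\<close> and \<open>finite_rank_lift\<close>; the depth two condition supplies
  it over \<open>A\<close> for the tensor square through \<open>summand_of_power_finite_rank\<close>, and \<open>finite_rank_descent\<close>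
  carries it over to \<open>B\<close>. The theory is developed for left modules; right modules are left modules over
  the opposite ring.
\<close>

section \<open>Linear maps, direct powers and natural modules\<close>

lemma left_linI:
  assumes "\<And>x. x \<in> carrier M \<Longrightarrow> f x \<in> carrier N"
    and "\<And>x y. \<lbrakk>x \<in> carrier M; y \<in> carrier M\<rbrakk> \<Longrightarrow> f (x \<oplus>\<^bsub>M\<^esub> y) = f x \<oplus>\<^bsub>N\<^esub> f y"
    and "\<And>r x. \<lbrakk>r \<in> carrier R; x \<in> carrier M\<rbrakk> \<Longrightarrow> f (smult M r x) = smult N r (f x)"
  shows "f \<in> left_lin R M N"
  using assms unfolding left_lin_def by (auto intro!: homI)

lemma left_linD:
  assumes "f \<in> left_lin R M N"
  shows "x \<in> carrier M \<Longrightarrow> f x \<in> carrier N"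
    and "\<lbrakk>x \<in> carrier M; y \<in> carrier M\<rbrakk> \<Longrightarrow> f (x \<oplus>\<^bsub>M\<^esub> y) = f x \<oplus>\<^bsub>N\<^esub> f y"
    and "\<lbrakk>r \<in> carrier R; x \<in> carrier M\<rbrakk> \<Longrightarrow> f (smult M r x) = smult N r (f x)"
  using assms unfolding left_lin_def hom_def by auto

lemma additive_homD:
  assumes "f \<in> hom (add_monoid M) (add_monoid N)"
  shows "x \<in> carrier M \<Longrightarrow> f x \<in> carrier N"
    and "\<lbrakk>x \<in> carrier M; y \<in> carrier M\<rbrakk> \<Longrightarrow> f (x \<oplus>\<^bsub>M\<^esub> y) = f x \<oplus>\<^bsub>N\<^esub> f y"
    and "\<lbrakk>abelian_group M; abelian_group N\<rbrakk> \<Longrightarrow> f \<zero>\<^bsub>M\<^esub> = \<zero>\<^bsub>N\<^esub>"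
  using assms hom_one[OF assms abelian_group.a_group abelian_group.a_group]
  unfolding hom_def by auto

lemma left_lin_additive: "f \<in> left_lin R M N \<Longrightarrow> f \<in> hom (add_monoid M) (add_monoid N)"
  by (simp add: left_lin_def)

lemma natural_bimodule_simps [simp]:
  "carrier (natural_bimodule A) = carrier A"
  "zero (natural_bimodule A) = zero A"
  "add (natural_bimodule A) = add A"
  "smult (natural_bimodule A) = mult A"
  "rsmult (natural_bimodule A) = mult A"
  by (simp_all add: natural_bimodule_def)

lemma direct_power_simps [simp]:
  "carrier (direct_power n M) = {..<n} \<rightarrow>\<^sub>E carrier M"
  "zero (direct_power n M) = (\<lambda>i\<in>{..<n}. \<zero>\<^bsub>M\<^esub>)"
  "add (direct_power n M) = (\<lambda>f g. \<lambda>i\<in>{..<n}. f i \<oplus>\<^bsub>M\<^esub> g i)"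
  "smult (direct_power n M) = (\<lambda>r f. \<lambda>i\<in>{..<n}. smult M r (f i))"
  "rsmult (direct_power n M) = (\<lambda>f s. \<lambda>i\<in>{..<n}. rsmult M (f i) s)"
  by (simp_all add: direct_power_def)

lemma (in left_module) smult_zero_left [simp]:
  assumes "x \<in> carrier M" shows "smult M \<zero>\<^bsub>R\<^esub> x = \<zero>\<^bsub>M\<^esub>"
proof -
  have "smult M \<zero>\<^bsub>R\<^esub> x \<oplus>\<^bsub>M\<^esub> smult M \<zero>\<^bsub>R\<^esub> x = smult M \<zero>\<^bsub>R\<^esub> x"
    using smult_add_left[of "\<zero>\<^bsub>R\<^esub>" "\<zero>\<^bsub>R\<^esub>" x] assms by simp
  then show ?thesis
    using assms smult_closed M.add.r_cancel_one' by force
qed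

lemma (in left_module) smult_zero_right [simp]:
  assumes "r \<in> carrier R" shows "smult M r \<zero>\<^bsub>M\<^esub> = \<zero>\<^bsub>M\<^esub>"
proof -
  have "smult M r \<zero>\<^bsub>M\<^esub> \<oplus>\<^bsub>M\<^esub> smult M r \<zero>\<^bsub>M\<^esub> = smult M r \<zero>\<^bsub>M\<^esub>"
    using smult_add_right[of r "\<zero>\<^bsub>M\<^esub>" "\<zero>\<^bsub>M\<^esub>"] assms by simp
  then show ?thesis
    using assms smult_closed M.add.r_cancel_one' by force
qed

lemma left_module_direct_power:
  assumes "left_module R M"
  shows "left_module R (direct_power n M)"
proof -
  interpret left_module R M by fact
  let ?V = "direct_power n M"
  have eqI: "f = g" if "f \<in> carrier ?V" "g \<in> carrier ?V" "\<And>i. i < n \<Longrightarrow> f i = g i" for f g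
    using that by (auto intro: PiE_ext)
  have comp: "f i \<in> carrier M" if "f \<in> carrier ?V" "i < n" for f i
    using that by auto
  have add: "f \<oplus>\<^bsub>?V\<^esub> g \<in> carrier ?V" if "f \<in> carrier ?V" "g \<in> carrier ?V" for f g
    using comp[OF that(1)] comp[OF that(2)] by simp
  have zero: "\<zero>\<^bsub>?V\<^esub> \<in> carrier ?V" by simp
  have smult: "smult ?V r f \<in> carrier ?V" if "r \<in> carrier R" "f \<in> carrier ?V" for r f
    using comp[OF that(2)] that(1) by (simp add: smult_closed)
  have "abelian_group ?V"
  proof (rule abelian_groupI)
    fix f assume f: "f \<in> carrier ?V"
    let ?g = "\<lambda>i\<in>{..<n}. \<ominus>\<^bsub>M\<^esub> f i"
    have g: "?g \<in> carrier ?V" using comp[OF f] by simp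
    have "?g \<oplus>\<^bsub>?V\<^esub> f = \<zero>\<^bsub>?V\<^esub>"
      by (rule eqI[OF add[OF g f] zero]) (simp add: comp[OF f] M.l_neg)
    with g show "\<exists>g\<in>carrier ?V. g \<oplus>\<^bsub>?V\<^esub> f = \<zero>\<^bsub>?V\<^esub>" by blast
    show "\<zero>\<^bsub>?V\<^esub> \<oplus>\<^bsub>?V\<^esub> f = f"
      by (rule eqI[OF add[OF zero f] f]) (simp add: comp[OF f])
  next
    fix f g h assume f: "f \<in> carrier ?V" and g: "g \<in> carrier ?V" and h: "h \<in> carrier ?V"
    show "f \<oplus>\<^bsub>?V\<^esub> g = g \<oplus>\<^bsub>?V\<^esub> f"
      by (rule eqI[OF add[OF f g] add[OF g f]]) (simp add: comp[OF f] comp[OF g] M.a_comm)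
    show "f \<oplus>\<^bsub>?V\<^esub> g \<oplus>\<^bsub>?V\<^esub> h = f \<oplus>\<^bsub>?V\<^esub> (g \<oplus>\<^bsub>?V\<^esub> h)"
      by (rule eqI[OF add[OF add[OF f g] h] add[OF f add[OF g h]]])
        (simp add: comp[OF f] comp[OF g] comp[OF h] M.a_assoc)
  qed (fact add zero)+
  moreover have "left_module_axioms R ?V"
  proof
    fix r s f g assume r: "r \<in> carrier R" and s: "s \<in> carrier R"
      and f: "f \<in> carrier ?V" and g: "g \<in> carrier ?V"
    note c = comp[OF f] comp[OF g] r s
    show "smult ?V (r \<oplus>\<^bsub>R\<^esub> s) f = smult ?V r f \<oplus>\<^bsub>?V\<^esub> smult ?V s f"
      by (rule eqI[OF smult[OF R.a_closed[OF r s] f] add[OF smult[OF r f] smult[OF s f]]])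
        (simp add: c smult_add_left)
    show "smult ?V r (f \<oplus>\<^bsub>?V\<^esub> g) = smult ?V r f \<oplus>\<^bsub>?V\<^esub> smult ?V r g"
      by (rule eqI[OF smult[OF r add[OF f g]] add[OF smult[OF r f] smult[OF r g]]])
        (simp add: c smult_add_right)
    show "smult ?V (r \<otimes>\<^bsub>R\<^esub> s) f = smult ?V r (smult ?V s f)"
      by (rule eqI[OF smult[OF R.m_closed[OF r s] f] smult[OF r smult[OF s f]]])
        (simp add: c smult_assoc)
  next
    fix f assume f: "f \<in> carrier ?V"
    show "smult ?V \<one>\<^bsub>R\<^esub> f = f"
      by (rule eqI[OF smult[OF R.one_closed f] f]) (simp add: comp[OF f] smult_one)
  qed (fact smult)
  ultimately show ?thesis
    by (intro left_module.intro R.ring_axioms)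
qed

lemma left_module_natural_subring:
  assumes "ring A" "subring B A"
  shows "left_module (base_ring A B) (natural_bimodule A)"
proof -
  interpret ring A by fact
  note B = subringE(1)[OF assms(2)]
  have "abelian_group (natural_bimodule A)"
    by (intro abelian_groupI) (auto simp: a_ac intro: add.l_inv_ex)
  then show ?thesis
    using B by (intro left_module.intro left_module_axioms.intro subring_is_ring[OF assms(2)])
      (auto simp: l_distr r_distr m_assoc subset_iff)
qed

lemma left_module_natural:
  assumes "ring A" shows "left_module A (natural_bimodule A)"
  using left_module_natural_subring[OF assms ring.carrier_is_subring[OF assms]] by simp

section \<open>Finite-rank maps and the dual basis criterion\<close>

text \<open>
  The maps \<open>x \<mapsto> \<psi>\<^sub>1(x) u\<^sub>1 + \<dots> + \<psi>\<^sub>k(x) u\<^sub>k\<close> with linear forms \<open>\<psi>\<^sub>i\<close>, that is, the linear maps that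
  factor through a finitely generated free module. Since \<open>M\<close> is finitely generated projective exactly
  when its identity is such a map (the dual basis lemma), the whole argument consists in showing that
  an identity map has finite rank. Building the sum one term at a time avoids indexed sums with
  repeated vectors \<open>u\<^sub>i\<close> and reduces every closure property below to a one-step induction. The
  functions are constrained on the carrier only.
\<close>

inductive finite_rank ::
    "('l, 'a) ring_scheme \<Rightarrow> ('l, 'm, 'b) module_scheme \<Rightarrow> ('l, 'n, 'c) module_scheme
      \<Rightarrow> ('m \<Rightarrow> 'n) \<Rightarrow> bool"
  for R M N where
    zero: "(\<And>x. x \<in> carrier M \<Longrightarrow> h x = \<zero>\<^bsub>N\<^esub>) \<Longrightarrow> finite_rank R M N h"
  | step: "\<lbrakk>finite_rank R M N h; \<psi> \<in> left_lin R M (natural_bimodule R); u \<in> carrier N;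
      \<And>x. x \<in> carrier M \<Longrightarrow> h' x = h x \<oplus>\<^bsub>N\<^esub> smult N (\<psi> x) u\<rbrakk> \<Longrightarrow> finite_rank R M N h'"

lemma dual_closed:
  assumes "\<psi> \<in> left_lin R M (natural_bimodule R)" "x \<in> carrier M"
  shows "\<psi> x \<in> carrier R"
  using left_linD(1)[OF assms] by simp

lemma finite_rank_cong:
  assumes "finite_rank R M N h" "\<And>x. x \<in> carrier M \<Longrightarrow> h' x = h x"
  shows "finite_rank R M N h'"
  using assms(1)
proof cases
  case zero
  then show ?thesis using assms(2) by (intro finite_rank.zero) simp
next
  case (step k \<psi> u)
  show ?thesis by (rule finite_rank.step[OF step(1-3)]) (simp add: step(4) assms(2))
qed

lemma finite_rank_closed:
  assumes "finite_rank R M N h" "left_module R N" "x \<in> carrier M"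
  shows "h x \<in> carrier N"
proof -
  interpret left_module R N by fact
  from assms(1) show ?thesis
    by induction (use assms(3) in \<open>auto intro: smult_closed dual_closed\<close>)
qed

lemma finite_rank_single:
  assumes "left_module R N" "\<psi> \<in> left_lin R M (natural_bimodule R)" "u \<in> carrier N"
    "\<And>x. x \<in> carrier M \<Longrightarrow> h x = smult N (\<psi> x) u"
  shows "finite_rank R M N h"
proof -
  interpret left_module R N by fact
  show ?thesis
    by (rule finite_rank.step[OF finite_rank.zero[of M "\<lambda>_. \<zero>\<^bsub>N\<^esub>"] assms(2,3)])
      (simp_all add: assms(4) smult_closed[OF dual_closed[OF assms(2)] assms(3)])
qed

lemma finite_rank_add:
  assumes "left_module R N" "finite_rank R M N h" "finite_rank R M N k"
  shows "finite_rank R M N (\<lambda>x. h x \<oplus>\<^bsub>N\<^esub> k x)"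
proof -
  interpret left_module R N by fact
  from assms(3) show ?thesis
  proof induction
    case (zero k)
    show ?case
      by (rule finite_rank_cong[OF assms(2)])
        (use zero finite_rank_closed[OF assms(2,1)] in auto)
  next
    case (step k \<psi> u k')
    show ?case
    proof (rule finite_rank.step[OF step.IH step.hyps(2,3)])
      fix x assume x: "x \<in> carrier M"
      show "h x \<oplus>\<^bsub>N\<^esub> k' x = h x \<oplus>\<^bsub>N\<^esub> k x \<oplus>\<^bsub>N\<^esub> smult N (\<psi> x) u"
        using step.hyps(3) step.hyps(4)[OF x] left_linD(1)[OF step.hyps(2) x] finite_rank_closed[OF assms(2,1) x]
          finite_rank_closed[OF step.hyps(1) assms(1) x]
        by (simp add: M.a_assoc smult_closed)
    qed
  qed
qed

lemma left_lin_comp: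
  assumes "f \<in> left_lin R M N" "g \<in> left_lin R N L"
  shows "(\<lambda>x. g (f x)) \<in> left_lin R M L"
  by (rule left_linI) (use assms in \<open>simp_all add: left_linD\<close>)

lemma finite_rank_precomp:
  assumes "finite_rank R M N h" "k \<in> left_lin R L M"
  shows "finite_rank R L N (\<lambda>x. h (k x))"
  using assms(1)
proof induction
  case (zero h)
  then show ?case using left_linD(1)[OF assms(2)] by (intro finite_rank.zero) auto
next
  case (step h \<psi> u h')
  show ?case
    by (rule finite_rank.step[OF step.IH left_lin_comp[OF assms(2) step.hyps(2)] step.hyps(3)])
      (use step.hyps(4) left_linD(1)[OF assms(2)] in auto)
qed

text \<open>
  The values of a finite-rank map lie in the span of the finitely many vectors in its expansion. The
  spanning family has to be a set, so a vector that occurs again has its coefficients merged.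
\<close>

lemma finite_rank_imp_spanned:
  assumes "left_module R N" "finite_rank R M N h"
  shows "\<exists>X. finite X \<and> X \<subseteq> carrier N \<and>
    (\<forall>m\<in>carrier M. \<exists>c \<in> X \<rightarrow> carrier R. h m = (\<Oplus>\<^bsub>N\<^esub>x\<in>X. smult N (c x) x))"
proof -
  interpret left_module R N by fact
  from assms(2) show ?thesis
  proof induction
    case (zero h)
    then show ?case by (intro exI[of _ "{}"]) auto
  next
    case (step h \<psi> u h')
    then obtain X where X: "finite X" "X \<subseteq> carrier N"
      and span: "\<And>m. m \<in> carrier M \<Longrightarrow>
        \<exists>c \<in> X \<rightarrow> carrier R. h m = (\<Oplus>\<^bsub>N\<^esub>x\<in>X. smult N (c x) x)"
      by blast
    have "\<exists>c \<in> insert u X \<rightarrow> carrier R. h' m = (\<Oplus>\<^bsub>N\<^esub>x\<in>insert u X. smult N (c x) x)"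
      if m: "m \<in> carrier M" for m
    proof -
      obtain c where c: "c \<in> X \<rightarrow> carrier R" "h m = (\<Oplus>\<^bsub>N\<^esub>x\<in>X. smult N (c x) x)"
        using span[OF m] by blast
      define r where "r = (if u \<in> X then c u else \<zero>\<^bsub>R\<^esub>)"
      have r: "r \<in> carrier R" and u: "u \<in> carrier N" and \<psi>: "\<psi> m \<in> carrier R"
        using c step.hyps(3) left_linD(1)[OF step.hyps(2) m] by (auto simp: r_def)
      let ?Y = "X - {u}"
      have cY: "(\<lambda>x. smult N (c x) x) \<in> ?Y \<rightarrow> carrier N"
        using c X by (auto intro!: smult_closed)
      have hm: "h m = smult N r u \<oplus>\<^bsub>N\<^esub> (\<Oplus>\<^bsub>N\<^esub>x\<in>?Y. smult N (c x) x)"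
      proof (cases "u \<in> X")
        case True
        then have "X = insert u ?Y" by auto
        then have "h m = (\<Oplus>\<^bsub>N\<^esub>x\<in>insert u ?Y. smult N (c x) x)"
          using c by simp
        also have "\<dots> = smult N (c u) u \<oplus>\<^bsub>N\<^esub> (\<Oplus>\<^bsub>N\<^esub>x\<in>?Y. smult N (c x) x)"
          using X cY r u True by (intro M.finsum_insert) (auto simp: r_def intro: smult_closed)
        finally show ?thesis using True by (simp add: r_def)
      next
        case False
        then show ?thesis using c u cY by (simp add: r_def M.finsum_closed)
      qed
      define d where "d = c(u := r \<oplus>\<^bsub>R\<^esub> \<psi> m)"
      have d: "d \<in> insert u X \<rightarrow> carrier R"
        using c r \<psi> by (auto simp: d_def)
      have "(\<Oplus>\<^bsub>N\<^esub>x\<in>insert u X. smult N (d x) x) = (\<Oplus>\<^bsub>N\<^esub>x\<in>insert u ?Y. smult N (d x) x)"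
        by simp
      also have "\<dots> = smult N (d u) u \<oplus>\<^bsub>N\<^esub> (\<Oplus>\<^bsub>N\<^esub>x\<in>?Y. smult N (d x) x)"
        using X u d by (intro M.finsum_insert) (auto intro!: smult_closed)
      also have "(\<Oplus>\<^bsub>N\<^esub>x\<in>?Y. smult N (d x) x) = (\<Oplus>\<^bsub>N\<^esub>x\<in>?Y. smult N (c x) x)"
        using cY by (intro M.finsum_cong') (auto simp: d_def)
      also have "smult N (d u) u \<oplus>\<^bsub>N\<^esub> \<dots> = h m \<oplus>\<^bsub>N\<^esub> smult N (\<psi> m) u"
        using r u \<psi> M.finsum_closed[OF cY]
        by (simp add: hm d_def smult_add_left smult_closed M.a_ac)
      finally show ?thesis
        using d step.hyps(4)[OF m] by (intro bexI[of _ d]) auto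
    qed
    then show ?case
      using X step.hyps(3) by (intro exI[of _ "insert u X"]) auto
  qed
qed

text \<open>
  A free module is projective, and this is the reason in terms of an expansion of \<open>h\<close>: choose for each
  vector \<open>u\<close> a preimage \<open>m\<close> of \<open>f u\<close> under \<open>g\<close>, and replace the term \<open>\<psi>(x) u\<close> by \<open>\<psi>(x) m\<close>.
  For \<open>h\<close> the identity this is the lifting property that defines projectivity.
\<close>

lemma finite_rank_lift:
  assumes "left_module R M" "left_module R N" "left_module R P"
    and "finite_rank R P Q h"
    and g: "g \<in> left_lin R M N" "g ` carrier M = carrier N"
    and f: "f \<in> left_lin R Q N" and Q: "left_module R Q"
  shows "\<exists>k \<in> left_lin R P M. \<forall>x\<in>carrier P. g (k x) = f (h x)"
proof -
  interpret M: left_module R M by fact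
  interpret N: left_module R N by fact
  interpret P: left_module R P by fact
  interpret Q: left_module R Q by fact
  note ag = M.abelian_group_axioms N.abelian_group_axioms Q.abelian_group_axioms
  note zero_map = additive_homD(3)[OF left_lin_additive]
  from assms(4) show ?thesis
  proof induction
    case (zero h)
    have "(\<lambda>_. \<zero>\<^bsub>M\<^esub>) \<in> left_lin R P M"
      by (rule left_linI) auto
    then show ?case
      using zero zero_map[OF g(1)] zero_map[OF f] ag by (intro bexI[of _ "\<lambda>_. \<zero>\<^bsub>M\<^esub>"]) auto
  next
    case (step h \<psi> u h')
    obtain k where k: "k \<in> left_lin R P M" "\<And>x. x \<in> carrier P \<Longrightarrow> g (k x) = f (h x)"
      using step.IH by blast
    have "f u \<in> carrier N" using step.hyps(3) left_linD(1)[OF f] by auto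
    then obtain m where m: "m \<in> carrier M" "g m = f u"
      using g(2) by (metis imageE)
    note \<psi> = left_linD[OF step.hyps(2), simplified]
    note k' = left_linD[OF k(1)]
    let ?k = "\<lambda>x. k x \<oplus>\<^bsub>M\<^esub> smult M (\<psi> x) m"
    have "?k \<in> left_lin R P M"
    proof (rule left_linI)
      show "?k (x \<oplus>\<^bsub>P\<^esub> y) = ?k x \<oplus>\<^bsub>M\<^esub> ?k y" if "x \<in> carrier P" "y \<in> carrier P" for x y
        using that m by (simp add: \<psi> k' M.smult_add_left M.smult_closed M.M.a_ac)
      show "?k (smult P r x) = smult M r (?k x)" if "r \<in> carrier R" "x \<in> carrier P" for r x
        using that m by (simp add: \<psi> k' M.smult_add_right M.smult_assoc M.smult_closed)
    qed (use m in \<open>simp add: \<psi> k' M.smult_closed\<close>)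
    moreover have "g (?k x) = f (h' x)" if x: "x \<in> carrier P" for x
      using x m step.hyps(3) step.hyps(4)[OF x] finite_rank_closed[OF step.hyps(1) Q x]
      by (simp add: left_linD[OF g(1)] left_linD[OF f] \<psi> k k' M.smult_closed Q.smult_closed)
    ultimately show ?case by (intro bexI[of _ ?k]) auto
  qed
qed

text \<open>
  With \<open>e\<^sub>k\<close> the standard basis of \<open>R\<^sup>n\<close> and \<open>f\<^sub>k\<close> the components of \<open>f\<close>, linearity of \<open>g\<close> gives
  \<open>g (f x) = f\<^sub>0(x) g(e\<^sub>0) + \<dots> + f\<^bsub>n-1\<^esub>(x) g(e\<^bsub>n-1\<^esub>)\<close>.
\<close>

lemma retract_of_power_finite_rank:
  assumes R: "ring R" and N: "left_module R N"
    and f: "f \<in> left_lin R M (direct_power n (natural_bimodule R))"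
    and g: "g \<in> left_lin R (direct_power n (natural_bimodule R)) N"
  shows "finite_rank R M N (\<lambda>x. g (f x))"
proof -
  interpret ring R by fact
  interpret N: left_module R N by fact
  let ?V = "direct_power n (natural_bimodule R)"
  interpret V: left_module R ?V
    by (rule left_module_direct_power[OF left_module_natural[OF R]])
  \<comment> \<open>Keeping only the first \<open>k\<close> components of \<open>f x\<close> turns the sum into an induction on \<open>k\<close>.\<close>
  define trunc where "trunc k v = (\<lambda>i\<in>{..<n}. if i < k then v i else \<zero>\<^bsub>R\<^esub>)" for k and v :: "nat \<Rightarrow> 'a"
  define e where "e k = (\<lambda>i\<in>{..<n}. if i = k then \<one>\<^bsub>R\<^esub> else \<zero>\<^bsub>R\<^esub>)" for k
  note f' = left_linD[OF f, simplified] and g' = left_linD[OF g, simplified]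
  have "finite_rank R M N (\<lambda>x. g (trunc k (f x)))" if "k \<le> n" for k
    using that
  proof (induction k)
    case 0
    have "trunc 0 v = \<zero>\<^bsub>?V\<^esub>" for v by (simp add: trunc_def)
    then show ?case
      using additive_homD(3)[OF left_lin_additive[OF g] V.abelian_group_axioms N.abelian_group_axioms]
      by (intro finite_rank.zero) (simp only:)
  next
    case (Suc k)
    have ev: "(\<lambda>x. f x k) \<in> left_lin R M (natural_bimodule R)"
      using f' Suc.prems by (intro left_linI) (auto simp: PiE_iff)
    show ?case
    proof (rule finite_rank.step[OF Suc.IH ev])
      show "g (e k) \<in> carrier N" by (rule g'(1)) (auto simp: e_def)
      fix x assume x: "x \<in> carrier M"
      have fx: "f x \<in> {..<n} \<rightarrow>\<^sub>E carrier R" "f x k \<in> carrier R"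
        using f'(1)[OF x] PiE_mem[OF f'(1)[OF x], of k] Suc.prems by simp_all
      then have fi: "f x i \<in> carrier R" if "i < n" for i
        using that by (simp add: PiE_iff)
      have "trunc (Suc k) (f x) = trunc k (f x) \<oplus>\<^bsub>?V\<^esub> smult ?V (f x k) (e k)"
        using fi fx(2) by (simp add: trunc_def e_def fun_eq_iff less_Suc_eq)
      moreover have "trunc k (f x) \<in> carrier ?V" "e k \<in> carrier ?V"
        using fi by (simp_all add: trunc_def e_def)
      ultimately show "g (trunc (Suc k) (f x)) = g (trunc k (f x)) \<oplus>\<^bsub>N\<^esub> smult N (f x k) (g (e k))"
        using fx(2) V.smult_closed[OF fx(2)] by (simp only: left_linD[OF g])
    qed (use Suc.prems in simp)
  qed
  from this[of n] have "finite_rank R M N (\<lambda>x. g (trunc n (f x)))" by simp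
  moreover have "trunc n (f x) = f x" if "x \<in> carrier M" for x
    using f'(1)[OF that] by (simp add: trunc_def fun_eq_iff PiE_iff extensional_def)
  ultimately show ?thesis by (auto intro: finite_rank_cong)
qed

text \<open>
  Every \<open>v\<close> in \<open>N = P \<oplus> Q\<close> is \<open>f m + q\<close> for a unique \<open>m\<close>; the retraction \<open>g\<close> sends \<open>v\<close> to this \<open>m\<close>.
  Uniqueness also yields its linearity, because \<open>Q\<close> is a submodule.
\<close>

lemma iso_to_direct_summand_retract:
  assumes M: "left_module R M" and N: "left_module R N"
    and iso: "iso_to_direct_summand R S M N"
  obtains f g where "f \<in> left_lin R M N" "g \<in> left_lin R N M" "\<And>x. x \<in> carrier M \<Longrightarrow> g (f x) = x"
proof -
  interpret M: left_module R M by fact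
  interpret N: left_module R N by fact
  obtain P Q f where P: "sub_bimodule R S N P" and Q: "sub_bimodule R S N Q"
    and sum: "P <+>\<^bsub>N\<^esub> Q = carrier N" and int: "P \<inter> Q = {\<zero>\<^bsub>N\<^esub>}"
    and f: "f \<in> bimod_hom R S M (N\<lparr>carrier := P\<rparr>)" and bij: "bij_betw f (carrier M) P"
    using iso unfolding iso_to_direct_summand_def direct_summand_def by blast
  have sub: "subgroup P (add_monoid N)" "subgroup Q (add_monoid N)"
    using P Q by (simp_all add: sub_bimodule_def)
  have PN: "P \<subseteq> carrier N" and QN: "Q \<subseteq> carrier N"
    using sub subgroup.subset by fastforce+
  have fP: "f x \<in> P" if "x \<in> carrier M" for x
    using bij that by (auto simp: bij_betw_def)
  have f': "f \<in> left_lin R M N"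
    using f fP PN by (auto simp: bimod_hom_def left_lin_def hom_def)
  note fD = left_linD[OF f']
  have ex: "\<exists>m\<in>carrier M. \<exists>q\<in>Q. v = f m \<oplus>\<^bsub>N\<^esub> q" if "v \<in> carrier N" for v
  proof -
    have "v \<in> P <+>\<^bsub>N\<^esub> Q" using that sum by simp
    then obtain p q where "p \<in> P" "q \<in> Q" "v = p \<oplus>\<^bsub>N\<^esub> q"
      unfolding set_add_def set_mult_def by auto
    then show ?thesis using bij by (auto simp: bij_betw_def)
  qed
  have uniq: "m = m'" if "m \<in> carrier M" "m' \<in> carrier M" "q \<in> Q" "q' \<in> Q"
    "f m \<oplus>\<^bsub>N\<^esub> q = f m' \<oplus>\<^bsub>N\<^esub> q'" for m m' q q'
  proof -
    have qN: "q \<in> carrier N" "q' \<in> carrier N" using that QN by auto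
    have "(f m' \<oplus>\<^bsub>N\<^esub> (q' \<ominus>\<^bsub>N\<^esub> q)) \<oplus>\<^bsub>N\<^esub> q = f m' \<oplus>\<^bsub>N\<^esub> q'"
      using that(2) fD qN by (simp add: a_minus_def N.M.a_assoc N.M.l_neg)
    then have "f m = f m' \<oplus>\<^bsub>N\<^esub> (q' \<ominus>\<^bsub>N\<^esub> q)"
      using N.M.add.right_cancel[of q "f m" "f m' \<oplus>\<^bsub>N\<^esub> (q' \<ominus>\<^bsub>N\<^esub> q)"] that(1,2,5) fD(1) qN by simp
    then have eq: "\<ominus>\<^bsub>N\<^esub> f m' \<oplus>\<^bsub>N\<^esub> f m = q' \<ominus>\<^bsub>N\<^esub> q"
      using that(1,2) fD qN by (simp add: N.M.r_neg1)
    have "\<ominus>\<^bsub>N\<^esub> f m' \<oplus>\<^bsub>N\<^esub> f m \<in> P"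
      using subgroup.m_closed[OF sub(1) subgroup.m_inv_closed[OF sub(1) fP] fP] that
      by (simp add: a_minus_def a_inv_def)
    moreover have "q' \<ominus>\<^bsub>N\<^esub> q \<in> Q"
      using subgroup.m_closed[OF sub(2) _ subgroup.m_inv_closed[OF sub(2)]] that
      by (simp add: a_minus_def a_inv_def)
    ultimately have "\<ominus>\<^bsub>N\<^esub> f m' \<oplus>\<^bsub>N\<^esub> f m = \<zero>\<^bsub>N\<^esub>" using int eq by auto
    then have "f m = f m'"
      using N.M.r_neg2[of "f m'" "f m"] that(1,2) fD(1) by simp
    then show ?thesis using bij that by (auto simp: bij_betw_def inj_on_def)
  qed
  define g where "g v = (SOME m. m \<in> carrier M \<and> (\<exists>q\<in>Q. v = f m \<oplus>\<^bsub>N\<^esub> q))" for v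
  have gP: "g v \<in> carrier M \<and> (\<exists>q\<in>Q. v = f (g v) \<oplus>\<^bsub>N\<^esub> q)" if "v \<in> carrier N" for v
    unfolding g_def by (rule someI_ex) (use ex[OF that] in blast)
  have g: "g v \<in> carrier M" "\<exists>q\<in>Q. v = f (g v) \<oplus>\<^bsub>N\<^esub> q" if "v \<in> carrier N" for v
    using gP[OF that] by blast+
  have g_eq: "g (f m \<oplus>\<^bsub>N\<^esub> q) = m" if m: "m \<in> carrier M" and q: "q \<in> Q" for m q
  proof -
    have v: "f m \<oplus>\<^bsub>N\<^esub> q \<in> carrier N" using m q fD QN by auto
    obtain q' where "q' \<in> Q" "f m \<oplus>\<^bsub>N\<^esub> q = f (g (f m \<oplus>\<^bsub>N\<^esub> q)) \<oplus>\<^bsub>N\<^esub> q'"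
      using g(2)[OF v] by (rule bexE)
    then show ?thesis using uniq[OF m g(1)[OF v] q] by metis
  qed
  have "g \<in> left_lin R N M"
  proof (rule left_linI)
    fix v w assume v: "v \<in> carrier N" and w: "w \<in> carrier N"
    obtain q where q: "q \<in> Q" "v = f (g v) \<oplus>\<^bsub>N\<^esub> q"
      using g(2)[OF v] by (rule bexE)
    obtain q' where q': "q' \<in> Q" "w = f (g w) \<oplus>\<^bsub>N\<^esub> q'"
      using g(2)[OF w] by (rule bexE)
    have "v \<oplus>\<^bsub>N\<^esub> w = (f (g v) \<oplus>\<^bsub>N\<^esub> q) \<oplus>\<^bsub>N\<^esub> (f (g w) \<oplus>\<^bsub>N\<^esub> q')"
      by (rule arg_cong2[where f="add N", OF q(2) q'(2)])
    also have "\<dots> = f (g v \<oplus>\<^bsub>M\<^esub> g w) \<oplus>\<^bsub>N\<^esub> (q \<oplus>\<^bsub>N\<^esub> q')"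
      using subsetD[OF QN q(1)] subsetD[OF QN q'(1)] fD(1)[OF g(1)[OF v]] fD(1)[OF g(1)[OF w]]
      by (simp add: fD(2)[OF g(1)[OF v] g(1)[OF w]] N.M.a_ac)
    finally have "v \<oplus>\<^bsub>N\<^esub> w = f (g v \<oplus>\<^bsub>M\<^esub> g w) \<oplus>\<^bsub>N\<^esub> (q \<oplus>\<^bsub>N\<^esub> q')" .
    moreover have "q \<oplus>\<^bsub>N\<^esub> q' \<in> Q"
      using subgroup.m_closed[OF sub(2) q(1) q'(1)] by simp
    ultimately show "g (v \<oplus>\<^bsub>N\<^esub> w) = g v \<oplus>\<^bsub>M\<^esub> g w"
      using g_eq g(1)[OF v] g(1)[OF w] by simp
  next
    fix r v assume r: "r \<in> carrier R" and v: "v \<in> carrier N"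
    obtain q where q: "q \<in> Q" "v = f (g v) \<oplus>\<^bsub>N\<^esub> q"
      using g(2)[OF v] by (rule bexE)
    have "smult N r v = smult N r (f (g v) \<oplus>\<^bsub>N\<^esub> q)"
      by (rule arg_cong[where f="smult N r", OF q(2)])
    also have "\<dots> = f (smult M r (g v)) \<oplus>\<^bsub>N\<^esub> smult N r q"
      using r subsetD[OF QN q(1)] fD(1)[OF g(1)[OF v]]
      by (simp add: fD(3)[OF r g(1)[OF v]] N.smult_add_right)
    finally have "smult N r v = f (smult M r (g v)) \<oplus>\<^bsub>N\<^esub> smult N r q" .
    moreover have "smult N r q \<in> Q" using Q r q(1) by (simp add: sub_bimodule_def)
    ultimately show "g (smult N r v) = smult M r (g v)"
      using g_eq[OF M.smult_closed[OF r g(1)[OF v]]] by simp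
  qed (rule g(1))
  moreover have "g (f x) = x" if "x \<in> carrier M" for x
  proof -
    have "\<zero>\<^bsub>N\<^esub> \<in> Q" using int by auto
    from g_eq[OF that this] show ?thesis using fD that by simp
  qed
  ultimately show ?thesis using that f' by blast
qed

text \<open>
  Transport of a finite-rank endomorphism from \<open>A\<close> down to the subring \<open>B\<close>. A term \<open>\<psi>(t) u\<close> of \<open>h\<close>
  contributes \<open>x \<mapsto> \<Phi> (\<psi>(\<iota> x) u)\<close>, which is the \<open>B\<close>-linear map \<open>x \<mapsto> \<psi>(\<iota> x)\<close> into \<open>A\<close> followed by
  \<open>a \<mapsto> \<Phi> (a u)\<close>, a finite-rank map over \<open>B\<close> by hypothesis.
\<close>

lemma finite_rank_descent:
  assumes A: "ring A" and B: "subring B A"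
    and T: "left_module A T" and P: "left_module (base_ring A B) P"
    and \<iota>: "\<iota> \<in> left_lin (base_ring A B) P T"
    and \<Phi>: "\<Phi> \<in> hom (add_monoid T) (add_monoid P)"
    and rank: "\<And>t. t \<in> carrier T \<Longrightarrow>
      finite_rank (base_ring A B) (natural_bimodule A) P (\<lambda>a. \<Phi> (smult T a t))"
    and h: "finite_rank A T T h"
  shows "finite_rank (base_ring A B) P P (\<lambda>x. \<Phi> (h (\<iota> x)))"
proof -
  interpret T: left_module A T by fact
  interpret P: left_module "base_ring A B" P by fact
  note BA = subringE(1)[OF B]
  note \<Phi>D = additive_homD[OF \<Phi>]
  from h show ?thesis
  proof induction
    case (zero h)
    then show ?case
      using \<Phi>D(3)[OF T.abelian_group_axioms P.abelian_group_axioms] left_linD(1)[OF \<iota>]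
      by (intro finite_rank.zero) auto
  next
    case (step h \<psi> u h')
    have "(\<lambda>x. \<psi> (\<iota> x)) \<in> left_lin (base_ring A B) P (natural_bimodule A)"
      using left_linD[OF \<iota>] left_linD[OF step.hyps(2)] BA by (intro left_linI) auto
    from finite_rank_add[OF P step.IH finite_rank_precomp[OF rank[OF step.hyps(3)] this]]
    show ?case
    proof (rule finite_rank_cong)
      fix x assume "x \<in> carrier P"
      then have x: "\<iota> x \<in> carrier T" by (rule left_linD(1)[OF \<iota>])
      then have "h (\<iota> x) \<in> carrier T" "smult T (\<psi> (\<iota> x)) u \<in> carrier T"
        using finite_rank_closed[OF step.hyps(1) T] left_linD(1)[OF step.hyps(2)] step.hyps(3)
        by (auto intro: T.smult_closed)
      then show "\<Phi> (h' (\<iota> x)) = \<Phi> (h (\<iota> x)) \<oplus>\<^bsub>P\<^esub> \<Phi> (smult T (\<psi> (\<iota> x)) u)"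
        using step.hyps(4)[OF x] \<Phi>D(2) by simp
    qed
  qed
qed

section \<open>Tensor products of modules\<close>

definition tensor_class ::
    "('r, 'a) ring_scheme \<Rightarrow> ('l, 'r, 'm, 'b) bimodule_scheme \<Rightarrow> ('r, 's, 'n, 'c) bimodule_scheme
      \<Rightarrow> ('m \<times> 'n \<Rightarrow>\<^sub>0 int) \<Rightarrow> ('m \<times> 'n \<Rightarrow>\<^sub>0 int) set"
  where "tensor_class R M N c =
    tensor_kernel R M N #>\<^bsub>free_Abelian_group (carrier M \<times> carrier N)\<^esub> c"

definition pure_tensor ::
    "('r, 'a) ring_scheme \<Rightarrow> ('l, 'r, 'm, 'b) bimodule_scheme \<Rightarrow> ('r, 's, 'n, 'c) bimodule_scheme
      \<Rightarrow> 'm \<Rightarrow> 'n \<Rightarrow> ('m \<times> 'n \<Rightarrow>\<^sub>0 int) set"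
  where "pure_tensor R M N x y = tensor_class R M N (frag_of (x, y))"

context
  fixes R :: "('r, 'a) ring_scheme" and M :: "('l, 'r, 'm, 'b) bimodule_scheme"
    and N :: "('r, 's, 'n, 'c) bimodule_scheme"
  assumes M: "right_module R M" and N: "left_module R N"
begin

interpretation M: right_module R M by (fact M)
interpretation N: left_module R N by (fact N)

private abbreviation (input) "F \<equiv> free_Abelian_group (carrier M \<times> carrier N)"
private abbreviation (input) "K \<equiv> tensor_kernel R M N"
private abbreviation (input) "T \<equiv> tensor R M N"
private abbreviation (input) "cls \<equiv> tensor_class R M N"
private abbreviation (input) "pure \<equiv> pure_tensor R M N"

interpretation F: comm_group F by (rule abelian_free_Abelian_group)

lemma frag_pair_carrier:
  "\<lbrakk>x \<in> carrier M; y \<in> carrier N\<rbrakk> \<Longrightarrow> frag_of (x, y) \<in> carrier F"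
  by simp

lemma frag_diff_carrier: "\<lbrakk>c \<in> carrier F; d \<in> carrier F\<rbrakk> \<Longrightarrow> c - d \<in> carrier F"
  using keys_diff[of c d] by auto

lemma tensor_relations_carrier: "tensor_relations R M N \<subseteq> carrier F"
proof
  fix c assume "c \<in> tensor_relations R M N"
  then show "c \<in> carrier F"
    unfolding tensor_relations_def
    by (elim UnE CollectE exE conjE; hypsubst)
      (intro frag_diff_carrier frag_pair_carrier M.M.a_closed N.M.a_closed M.rsmult_closed N.smult_closed;
        assumption)+
qed

lemma tensor_kernel_normal: "K \<lhd> F"
  unfolding tensor_kernel_def
  by (intro F.subgroup_imp_normal F.generate_is_subgroup tensor_relations_carrier)

lemma tensor_record:
  "carrier T = carrier (F Mod K)" "zero T = one (F Mod K)" "add T = mult (F Mod K)"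
  "smult T = (\<lambda>l C. K <#>\<^bsub>F\<^esub> frag_extend (\<lambda>(x, y). frag_of (smult M l x, y)) ` C)"
  "rsmult T = (\<lambda>C s. K <#>\<^bsub>F\<^esub> frag_extend (\<lambda>(x, y). frag_of (x, rsmult N y s)) ` C)"
  by (simp_all add: tensor_def Let_def)

lemma abelian_group_tensor: "abelian_group T"
proof -
  interpret Q: comm_group "F Mod K"
    by (rule F.abelian_FactGroup[OF normal_imp_subgroup[OF tensor_kernel_normal]])
  show ?thesis
    by (rule abelian_groupI)
      (unfold tensor_record,
        (rule Q.m_closed Q.one_closed Q.m_assoc Q.m_comm Q.l_one Q.l_inv_ex; assumption)+)
qed

interpretation T: abelian_group T by (rule abelian_group_tensor)

lemma tensor_class_additive: "cls \<in> hom F (add_monoid T)"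
  using normal.r_coset_hom_Mod[OF tensor_kernel_normal]
  by (simp add: hom_def tensor_record tensor_class_def[abs_def])

lemma tensor_class_closed: "c \<in> carrier F \<Longrightarrow> cls c \<in> carrier T"
  using tensor_class_additive by (auto simp: hom_def)

lemma tensor_class_add:
  "\<lbrakk>c \<in> carrier F; d \<in> carrier F\<rbrakk> \<Longrightarrow> cls (c + d) = cls c \<oplus>\<^bsub>T\<^esub> cls d"
  using tensor_class_additive by (auto simp: hom_def)

lemma tensor_class_zero: "cls 0 = \<zero>\<^bsub>T\<^esub>"
  using hom_one[OF tensor_class_additive F.is_group T.a_group] by simp

lemma tensor_class_kernel:
  assumes "c \<in> K" shows "cls c = \<zero>\<^bsub>T\<^esub>"
proof -
  have "K #>\<^bsub>F\<^esub> c = K"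
    using assms normal_imp_subgroup[OF tensor_kernel_normal] subgroup.subset
    by (intro F.coset_join2) blast+
  then show ?thesis by (simp add: tensor_class_def tensor_record)
qed

lemma tensor_class_cancel:
  assumes "c \<in> carrier F" "d \<in> carrier F" "c - d \<in> K"
  shows "cls c = cls d"
proof -
  have "c - d \<in> carrier F"
    using assms(3) normal_imp_subgroup[OF tensor_kernel_normal] subgroup.subset by blast
  from tensor_class_add[OF this assms(2)] show ?thesis
    using tensor_class_kernel[OF assms(3)] T.l_zero[OF tensor_class_closed[OF assms(2)]] by simp
qed

lemma pure_tensor_closed: "\<lbrakk>x \<in> carrier M; y \<in> carrier N\<rbrakk> \<Longrightarrow> pure x y \<in> carrier T"
  unfolding pure_tensor_def by (intro tensor_class_closed) simp

lemma pure_tensor_add_left: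
  assumes "x \<in> carrier M" "x' \<in> carrier M" "y \<in> carrier N"
  shows "pure (x \<oplus>\<^bsub>M\<^esub> x') y = pure x y \<oplus>\<^bsub>T\<^esub> pure x' y"
proof -
  have "frag_of (x \<oplus>\<^bsub>M\<^esub> x', y) - frag_of (x, y) - frag_of (x', y) \<in> tensor_relations R M N"
    using assms unfolding tensor_relations_def by blast
  then have "frag_of (x \<oplus>\<^bsub>M\<^esub> x', y) - (frag_of (x, y) + frag_of (x', y)) \<in> K"
    unfolding tensor_kernel_def by (simp add: generate.incl diff_diff_eq)
  moreover have "frag_of (x, y) + frag_of (x', y) \<in> carrier F"
    using F.m_closed[OF frag_pair_carrier[OF assms(1,3)] frag_pair_carrier[OF assms(2,3)]] by (simp only: mult_free_Abelian_group)
  ultimately have "pure (x \<oplus>\<^bsub>M\<^esub> x') y = cls (frag_of (x, y) + frag_of (x', y))"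
    unfolding pure_tensor_def using assms
    by (intro tensor_class_cancel frag_pair_carrier M.M.a_closed)
  then show ?thesis
    unfolding pure_tensor_def using assms by (simp add: tensor_class_add)
qed

lemma pure_tensor_add_right:
  assumes "x \<in> carrier M" "y \<in> carrier N" "y' \<in> carrier N"
  shows "pure x (y \<oplus>\<^bsub>N\<^esub> y') = pure x y \<oplus>\<^bsub>T\<^esub> pure x y'"
proof -
  have "frag_of (x, y \<oplus>\<^bsub>N\<^esub> y') - frag_of (x, y) - frag_of (x, y') \<in> tensor_relations R M N"
    using assms unfolding tensor_relations_def by blast
  then have "frag_of (x, y \<oplus>\<^bsub>N\<^esub> y') - (frag_of (x, y) + frag_of (x, y')) \<in> K"
    unfolding tensor_kernel_def by (simp add: generate.incl diff_diff_eq)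
  moreover have "frag_of (x, y) + frag_of (x, y') \<in> carrier F"
    using F.m_closed[OF frag_pair_carrier[OF assms(1,2)] frag_pair_carrier[OF assms(1,3)]] by (simp only: mult_free_Abelian_group)
  ultimately have "pure x (y \<oplus>\<^bsub>N\<^esub> y') = cls (frag_of (x, y) + frag_of (x, y'))"
    unfolding pure_tensor_def using assms
    by (intro tensor_class_cancel frag_pair_carrier N.M.a_closed)
  then show ?thesis
    unfolding pure_tensor_def using assms by (simp add: tensor_class_add)
qed

lemma pure_tensor_balanced:
  assumes "x \<in> carrier M" "r \<in> carrier R" "y \<in> carrier N"
  shows "pure (rsmult M x r) y = pure x (smult N r y)"
proof -
  have "frag_of (rsmult M x r, y) - frag_of (x, smult N r y) \<in> tensor_relations R M N"
    using assms unfolding tensor_relations_def by blast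
  then show ?thesis
    unfolding pure_tensor_def tensor_kernel_def
    using assms M.rsmult_closed N.smult_closed
    by (intro tensor_class_cancel frag_pair_carrier) (simp_all add: tensor_kernel_def generate.incl)
qed

lemma tensor_class_surj:
  assumes "t \<in> carrier T" obtains c where "c \<in> carrier F" "t = cls c"
  using assms by (auto simp: tensor_record carrier_FactGroup tensor_class_def)

text \<open>
  Negatives of pure tensors are pure, \<open>- (x \<otimes> y) = (- x) \<otimes> y\<close>, so sums of pure tensors exhaust the
  tensor product and subtraction does not have to be considered.
\<close>

lemma tensor_induct:
  assumes t: "t \<in> carrier T"
    and zero: "P \<zero>\<^bsub>T\<^esub>"
    and add: "\<And>t u. \<lbrakk>t \<in> carrier T; u \<in> carrier T; P t; P u\<rbrakk> \<Longrightarrow> P (t \<oplus>\<^bsub>T\<^esub> u)"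
    and pure: "\<And>x y. \<lbrakk>x \<in> carrier M; y \<in> carrier N\<rbrakk> \<Longrightarrow> P (pure x y)"
  shows "P t"
proof -
  have neg: "cls (- frag_of (x, y)) = pure (\<ominus>\<^bsub>M\<^esub> x) y" if "x \<in> carrier M" "y \<in> carrier N" for x y
  proof -
    have "pure \<zero>\<^bsub>M\<^esub> y \<oplus>\<^bsub>T\<^esub> pure \<zero>\<^bsub>M\<^esub> y = pure \<zero>\<^bsub>M\<^esub> y"
      using pure_tensor_add_left[of "\<zero>\<^bsub>M\<^esub>" "\<zero>\<^bsub>M\<^esub>" y] that by simp
    then have "pure \<zero>\<^bsub>M\<^esub> y = \<zero>\<^bsub>T\<^esub>"
      using that pure_tensor_closed T.add.r_cancel_one' by (metis M.M.zero_closed)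
    then have "pure x y \<oplus>\<^bsub>T\<^esub> pure (\<ominus>\<^bsub>M\<^esub> x) y = \<zero>\<^bsub>T\<^esub>"
      using pure_tensor_add_left[of x "\<ominus>\<^bsub>M\<^esub> x" y] that by (simp add: M.M.r_neg)
    moreover have "- frag_of (x, y) \<in> carrier F"
      using that by simp
    moreover from this have "pure x y \<oplus>\<^bsub>T\<^esub> cls (- frag_of (x, y)) = \<zero>\<^bsub>T\<^esub>"
      using tensor_class_add[of "frag_of (x, y)" "- frag_of (x, y)"] that
      by (simp add: pure_tensor_def tensor_class_zero)
    ultimately show ?thesis
      using that pure_tensor_closed tensor_class_closed
      by (metis M.M.a_inv_closed T.a_comm T.add.right_cancel)
  qed
  obtain c where c: "c \<in> carrier F" "t = cls c" using t by (rule tensor_class_surj)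
  have "P (cls c) \<and> P (cls (- c))"
  proof (rule free_Abelian_group_induct[of c "carrier M \<times> carrier N"])
    show "P (cls 0) \<and> P (cls (- 0))" using zero by (simp add: tensor_class_zero)
  next
    fix c d :: "'m \<times> 'n \<Rightarrow>\<^sub>0 int"
    assume "Poly_Mapping.keys c \<subseteq> carrier M \<times> carrier N" "Poly_Mapping.keys d \<subseteq> carrier M \<times> carrier N"
    then have F: "c \<in> carrier F" "d \<in> carrier F" "- c \<in> carrier F" "- d \<in> carrier F" by auto
    assume "P (cls c) \<and> P (cls (- c))" "P (cls d) \<and> P (cls (- d))"
    then have "P (cls (c + - d))" "P (cls (- c + d))"
      using F by (simp_all only: tensor_class_add add tensor_class_closed)
    then show "P (cls (c - d)) \<and> P (cls (- (c - d)))" by simp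
  next
    fix z assume "z \<in> carrier M \<times> carrier N"
    then show "P (cls (frag_of z)) \<and> P (cls (- frag_of z))"
      using pure neg M.M.a_inv_closed unfolding pure_tensor_def by (cases z) auto
  qed (use c in simp)
  then show ?thesis using c by simp
qed

text \<open>
  The biadditive map \<open>\<beta>\<close> extends to the free abelian group on pairs, and its additivity in each variable and
  balance say that this extension kills the three families of relations.
\<close>

lemma tensor_universal:
  fixes G :: "('g, 'd) ring_scheme"
  assumes G: "abelian_group G"
    and closed: "\<And>x y. \<lbrakk>x \<in> carrier M; y \<in> carrier N\<rbrakk> \<Longrightarrow> \<beta> x y \<in> carrier G"
    and add_left: "\<And>x x' y. \<lbrakk>x \<in> carrier M; x' \<in> carrier M; y \<in> carrier N\<rbrakk> \<Longrightarrow>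
      \<beta> (x \<oplus>\<^bsub>M\<^esub> x') y = \<beta> x y \<oplus>\<^bsub>G\<^esub> \<beta> x' y"
    and add_right: "\<And>x y y'. \<lbrakk>x \<in> carrier M; y \<in> carrier N; y' \<in> carrier N\<rbrakk> \<Longrightarrow>
      \<beta> x (y \<oplus>\<^bsub>N\<^esub> y') = \<beta> x y \<oplus>\<^bsub>G\<^esub> \<beta> x y'"
    and balanced: "\<And>x r y. \<lbrakk>x \<in> carrier M; r \<in> carrier R; y \<in> carrier N\<rbrakk> \<Longrightarrow>
      \<beta> (rsmult M x r) y = \<beta> x (smult N r y)"
  obtains f where "f \<in> hom (add_monoid T) (add_monoid G)"
    "\<And>x y. \<lbrakk>x \<in> carrier M; y \<in> carrier N\<rbrakk> \<Longrightarrow> f (pure x y) = \<beta> x y"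
proof -
  interpret G: abelian_group G by (fact G)
  have "case_prod \<beta> ` (carrier M \<times> carrier N) \<subseteq> carrier (add_monoid G)"
    using closed by auto
  then obtain h where h: "h \<in> hom F (add_monoid G)"
    and h_of: "\<And>z. z \<in> carrier M \<times> carrier N \<Longrightarrow> h (frag_of z) = case_prod \<beta> z"
    by (rule comm_group.free_Abelian_group_universal[OF G.a_comm_group]) blast
  interpret h: group_hom F "add_monoid G" h
    by (simp add: group_hom_def group_hom_axioms_def h G.a_group F.is_group)
  have h_diff: "h (c - d) = h c \<ominus>\<^bsub>G\<^esub> h d" if "c \<in> carrier F" "d \<in> carrier F" for c d
  proof -
    have "h (c \<otimes>\<^bsub>F\<^esub> inv\<^bsub>F\<^esub> d) = h c \<otimes>\<^bsub>add_monoid G\<^esub> inv\<^bsub>add_monoid G\<^esub> h d"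
      using that by (simp only: h.hom_mult h.hom_inv F.inv_closed)
    then show ?thesis
      using that by (simp add: a_minus_def a_inv_def)
  qed
  have rel: "h c = \<zero>\<^bsub>G\<^esub>" if "c \<in> tensor_relations R M N" for c
    using that unfolding tensor_relations_def
  proof (elim UnE CollectE exE conjE; hypsubst)
    fix x x' y assume *: "x \<in> carrier M" "x' \<in> carrier M" "y \<in> carrier N"
    note F = frag_pair_carrier[OF M.M.a_closed[OF *(1,2)] *(3)] frag_pair_carrier[OF *(1,3)]
      frag_pair_carrier[OF *(2,3)]
    show "h (frag_of (x \<oplus>\<^bsub>M\<^esub> x', y) - frag_of (x, y) - frag_of (x', y)) = \<zero>\<^bsub>G\<^esub>"
      using * closed[OF *(1,3)] closed[OF *(2,3)]
      by (simp add: h_diff[OF frag_diff_carrier[OF F(1,2)] F(3)] h_diff[OF F(1,2)] h_of add_left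
          a_minus_def G.a_ac G.r_neg G.r_neg1 G.r_neg2)
  next
    fix x y y' assume *: "x \<in> carrier M" "y \<in> carrier N" "y' \<in> carrier N"
    note F = frag_pair_carrier[OF *(1) N.M.a_closed[OF *(2,3)]] frag_pair_carrier[OF *(1,2)]
      frag_pair_carrier[OF *(1,3)]
    show "h (frag_of (x, y \<oplus>\<^bsub>N\<^esub> y') - frag_of (x, y) - frag_of (x, y')) = \<zero>\<^bsub>G\<^esub>"
      using * closed[OF *(1,2)] closed[OF *(1,3)]
      by (simp add: h_diff[OF frag_diff_carrier[OF F(1,2)] F(3)] h_diff[OF F(1,2)] h_of add_right
          a_minus_def G.a_ac G.r_neg G.r_neg1 G.r_neg2)
  next
    fix x r y assume *: "x \<in> carrier M" "r \<in> carrier R" "y \<in> carrier N"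
    note F = frag_pair_carrier[OF M.rsmult_closed[OF *(1,2)] *(3)]
      frag_pair_carrier[OF *(1) N.smult_closed[OF *(2,3)]]
    show "h (frag_of (rsmult M x r, y) - frag_of (x, smult N r y)) = \<zero>\<^bsub>G\<^esub>"
      using * closed[OF *(1) N.smult_closed[OF *(2,3)]]
      by (simp add: h_diff[OF F] h_of balanced M.rsmult_closed N.smult_closed a_minus_def G.r_neg)
  qed
  have "K \<subseteq> kernel F (add_monoid G) h"
    unfolding tensor_kernel_def
    by (rule F.generate_subgroup_incl[OF _ h.subgroup_kernel])
      (use rel tensor_relations_carrier in \<open>unfold kernel_def, auto simp only: monoid.simps\<close>)
  from h.FactGroup_universal_kernel[OF tensor_kernel_normal this]
  obtain f where f: "f \<in> hom (F Mod K) (add_monoid G)"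
    "\<And>c. c \<in> carrier F \<Longrightarrow> f (K #>\<^bsub>F\<^esub> c) = h c" by blast
  show ?thesis
  proof
    show "f \<in> hom (add_monoid T) (add_monoid G)"
      using f(1) by (simp add: hom_def tensor_record)
    show "f (pure x y) = \<beta> x y" if "x \<in> carrier M" "y \<in> carrier N" for x y
      using f(2)[OF frag_pair_carrier[OF that]] h_of that by (simp add: pure_tensor_def tensor_class_def)
  qed
qed

text \<open>
  The common source of the left and the right action: the map induced on cosets by the endomorphism
  \<open>(x, y) \<mapsto> (\<phi> x, \<gamma> y)\<close> of the free group. It sends relations to relations, hence the kernel into
  itself, so the saturation of the image of a coset is again a single coset.
\<close>

lemma tensor_action:
  assumes \<phi>: "\<phi> \<in> right_lin R M M" and \<gamma>: "\<gamma> \<in> left_lin R N N"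
  defines "E \<equiv> \<lambda>C. K <#>\<^bsub>F\<^esub> frag_extend (\<lambda>(x, y). frag_of (\<phi> x, \<gamma> y)) ` C"
  shows "E \<in> hom (add_monoid T) (add_monoid T)"
    and "\<And>x y. \<lbrakk>x \<in> carrier M; y \<in> carrier N\<rbrakk> \<Longrightarrow> E (pure x y) = pure (\<phi> x) (\<gamma> y)"
proof -
  let ?e = "frag_extend (\<lambda>(x, y). frag_of (\<phi> x, \<gamma> y))"
  have \<phi>D: "\<And>x. x \<in> carrier M \<Longrightarrow> \<phi> x \<in> carrier M"
    "\<And>x y. \<lbrakk>x \<in> carrier M; y \<in> carrier M\<rbrakk> \<Longrightarrow> \<phi> (x \<oplus>\<^bsub>M\<^esub> y) = \<phi> x \<oplus>\<^bsub>M\<^esub> \<phi> y"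
    "\<And>x r. \<lbrakk>x \<in> carrier M; r \<in> carrier R\<rbrakk> \<Longrightarrow> \<phi> (rsmult M x r) = rsmult M (\<phi> x) r"
    using \<phi> by (auto simp: right_lin_def hom_def)
  note \<gamma>D = left_linD[OF \<gamma>]
  have e_F: "?e c \<in> carrier F" if "c \<in> carrier F" for c
  proof -
    have "z \<in> carrier M \<times> carrier N" if "z \<in> Poly_Mapping.keys (?e c)" for z
    proof -
      have "z \<in> (\<Union>p\<in>Poly_Mapping.keys c. Poly_Mapping.keys (case p of (x, y) \<Rightarrow> frag_of (\<phi> x, \<gamma> y)))"
        using that keys_frag_extend by (rule rev_subsetD)
      then obtain x y where "(x, y) \<in> Poly_Mapping.keys c" "z = (\<phi> x, \<gamma> y)"
        by (auto split: prod.splits)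
      then show ?thesis using \<open>c \<in> carrier F\<close> \<phi>D(1) \<gamma>D(1) by auto
    qed
    then show ?thesis by auto
  qed
  have "?e c \<in> K" if "c \<in> K" for c
    using that unfolding tensor_kernel_def
  proof induction
    case one
    then show ?case using generate.one[of F] by simp
  next
    case (eng c d)
    then show ?case using generate.eng by (fastforce simp: frag_extend_add)
  next
    have rel: "?e c \<in> tensor_relations R M N" if "c \<in> tensor_relations R M N" for c
      using that[unfolded tensor_relations_def]
    proof (elim UnE CollectE exE conjE; hypsubst)
      fix x x' y assume *: "x \<in> carrier M" "x' \<in> carrier M" "y \<in> carrier N"
      show "?e (frag_of (x \<oplus>\<^bsub>M\<^esub> x', y) - frag_of (x, y) - frag_of (x', y)) \<in> tensor_relations R M N"
        unfolding tensor_relations_def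
        by (rule UnI1, rule UnI1, intro CollectI exI[of _ "\<phi> x"] exI[of _ "\<phi> x'"] exI[of _ "\<gamma> y"])
          (use * in \<open>simp add: frag_extend_diff \<phi>D \<gamma>D\<close>)
    next
      fix x y y' assume *: "x \<in> carrier M" "y \<in> carrier N" "y' \<in> carrier N"
      show "?e (frag_of (x, y \<oplus>\<^bsub>N\<^esub> y') - frag_of (x, y) - frag_of (x, y')) \<in> tensor_relations R M N"
        unfolding tensor_relations_def
        by (rule UnI1, rule UnI2, intro CollectI exI[of _ "\<phi> x"] exI[of _ "\<gamma> y"] exI[of _ "\<gamma> y'"])
          (use * in \<open>simp add: frag_extend_diff \<phi>D \<gamma>D\<close>)
    next
      fix x r y assume *: "x \<in> carrier M" "r \<in> carrier R" "y \<in> carrier N"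
      show "?e (frag_of (rsmult M x r, y) - frag_of (x, smult N r y)) \<in> tensor_relations R M N"
        unfolding tensor_relations_def
        by (rule UnI2, intro CollectI exI[of _ "\<phi> x"] exI[of _ r] exI[of _ "\<gamma> y"])
          (use * in \<open>simp add: frag_extend_diff \<phi>D \<gamma>D\<close>)
    qed
    case (incl c)
    then show ?case by (intro generate.incl rel)
    case (inv c)
    have "c \<in> carrier F" "?e c \<in> carrier F"
      using inv rel tensor_relations_carrier by blast+
    then show ?case
      using generate.inv[OF rel[OF inv], of F] by (simp add: frag_extend_minus)
  qed
  then have e_K: "?e ` K \<subseteq> K" by blast
  interpret K: normal K F by (rule tensor_kernel_normal)
  have E_cls: "E (cls c) = cls (?e c)" if c: "c \<in> carrier F" for c
  proof (rule Set.set_eqI)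
    fix z
    have "z \<in> E (cls c) \<longleftrightarrow> (\<exists>k\<in>K. \<exists>k'\<in>K. z = k + ?e (k' + c))"
      by (auto simp: E_def tensor_class_def set_mult_def r_coset_def)
    also have "\<dots> \<longleftrightarrow> (\<exists>k\<in>K. z = k + ?e c)"
    proof safe
      fix k k' assume k: "k \<in> K" "k' \<in> K"
      then have "k + ?e k' \<in> K" using e_K K.m_closed by fastforce
      then show "\<exists>k''\<in>K. k + ?e (k' + c) = k'' + ?e c"
        by (intro bexI[of _ "k + ?e k'"]) (simp_all add: frag_extend_add)
    next
      fix k assume "k \<in> K"
      then show "\<exists>k'\<in>K. \<exists>k''\<in>K. k + ?e c = k' + ?e (k'' + c)"
        using K.one_closed by (intro bexI[of _ k] bexI[of _ 0]) simp_all
    qed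
    also have "\<dots> \<longleftrightarrow> z \<in> cls (?e c)"
      by (auto simp: tensor_class_def r_coset_def)
    finally show "z \<in> E (cls c) \<longleftrightarrow> z \<in> cls (?e c)" .
  qed
  show "E (pure x y) = pure (\<phi> x) (\<gamma> y)" if "x \<in> carrier M" "y \<in> carrier N" for x y
    using E_cls[OF frag_pair_carrier[OF that]] by (simp add: pure_tensor_def)
  show "E \<in> hom (add_monoid T) (add_monoid T)"
  proof (rule homI; simp)
    fix t assume "t \<in> carrier T"
    then obtain c where c: "c \<in> carrier F" "t = cls c" by (rule tensor_class_surj)
    then show "E t \<in> carrier T" by (simp only: E_cls e_F tensor_class_closed)
    fix u assume "u \<in> carrier T"
    then obtain d where d: "d \<in> carrier F" "u = cls d" by (rule tensor_class_surj)
    have "c + d \<in> carrier F" using F.m_closed[OF c(1) d(1)] by (simp only: mult_free_Abelian_group)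
    then have "E (cls (c + d)) = cls (?e c + ?e d)" by (simp add: E_cls frag_extend_add)
    then show "E (t \<oplus>\<^bsub>T\<^esub> u) = E t \<oplus>\<^bsub>T\<^esub> E u"
      using c d by (simp only: E_cls e_F tensor_class_add)
  qed
qed

lemma tensor_smult:
  assumes "smult M l \<in> right_lin R M M"
  shows "smult T l \<in> hom (add_monoid T) (add_monoid T)"
    and "\<And>x y. \<lbrakk>x \<in> carrier M; y \<in> carrier N\<rbrakk> \<Longrightarrow> smult T l (pure x y) = pure (smult M l x) y"
proof -
  have "(\<lambda>y. y) \<in> left_lin R N N" by (rule left_linI) auto
  from tensor_action[OF assms this]
  show "smult T l \<in> hom (add_monoid T) (add_monoid T)"
    and "\<And>x y. \<lbrakk>x \<in> carrier M; y \<in> carrier N\<rbrakk> \<Longrightarrow> smult T l (pure x y) = pure (smult M l x) y"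
    by (simp_all add: tensor_record)
qed

lemma tensor_rsmult:
  assumes "(\<lambda>y. rsmult N y s) \<in> left_lin R N N"
  shows "(\<lambda>t. rsmult T t s) \<in> hom (add_monoid T) (add_monoid T)"
    and "\<And>x y. \<lbrakk>x \<in> carrier M; y \<in> carrier N\<rbrakk> \<Longrightarrow> rsmult T (pure x y) s = pure x (rsmult N y s)"
proof -
  have "(\<lambda>x. x) \<in> right_lin R M M" by (auto simp: right_lin_def hom_def)
  from tensor_action[OF this assms]
  show "(\<lambda>t. rsmult T t s) \<in> hom (add_monoid T) (add_monoid T)"
    and "\<And>x y. \<lbrakk>x \<in> carrier M; y \<in> carrier N\<rbrakk> \<Longrightarrow> rsmult T (pure x y) s = pure x (rsmult N y s)"
    by (simp_all add: tensor_record)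
qed

text \<open>
  Each action map is additive, so an identity between additive maps need only be checked on pure
  tensors. The hypothesis \<open>lin\<close> is the compatibility of the two actions of an \<open>L\<close>-\<open>R\<close>-bimodule \<open>M\<close>.
\<close>

lemma left_module_tensor:
  fixes L :: "('l, 'd) ring_scheme"
  assumes L: "left_module L M"
    and lin: "\<And>l. l \<in> carrier L \<Longrightarrow> smult M l \<in> right_lin R M M"
  shows "left_module L T"
proof -
  interpret L: left_module L M by (fact L)
  note act = tensor_smult[OF lin]
  note actD = additive_homD[OF act(1)]
  have zero: "smult T l \<zero>\<^bsub>T\<^esub> = \<zero>\<^bsub>T\<^esub>" if "l \<in> carrier L" for l
    using actD(3)[OF that] abelian_group_tensor by simp
  show ?thesis
  proof (intro left_module.intro left_module_axioms.intro L.R.ring_axioms abelian_group_tensor)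
    show "smult T l t \<in> carrier T" if "l \<in> carrier L" "t \<in> carrier T" for l t
      using that by (rule actD(1))
    show "smult T l (t \<oplus>\<^bsub>T\<^esub> u) = smult T l t \<oplus>\<^bsub>T\<^esub> smult T l u"
      if "l \<in> carrier L" "t \<in> carrier T" "u \<in> carrier T" for l t u
      using that by (rule actD(2))
  next
    fix k l t assume k: "k \<in> carrier L" and l: "l \<in> carrier L" and t: "t \<in> carrier T"
    show "smult T (k \<oplus>\<^bsub>L\<^esub> l) t = smult T k t \<oplus>\<^bsub>T\<^esub> smult T l t"
      using t
      by (rule tensor_induct)
        (use k l in \<open>simp_all add: zero actD T.a_ac act(2) L.smult_add_left L.smult_closed pure_tensor_add_left\<close>)
    show "smult T (k \<otimes>\<^bsub>L\<^esub> l) t = smult T k (smult T l t)"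
      using t
      by (rule tensor_induct)
        (use k l in \<open>simp_all add: zero actD act(2) L.smult_assoc L.smult_closed\<close>)
  next
    fix t assume t: "t \<in> carrier T"
    show "smult T \<one>\<^bsub>L\<^esub> t = t"
      using t by (rule tensor_induct) (simp_all add: zero actD act(2) L.smult_one)
  qed
qed

lemma right_module_tensor:
  fixes S :: "('s, 'd) ring_scheme"
  assumes S: "right_module S N"
    and lin: "\<And>s. s \<in> carrier S \<Longrightarrow> (\<lambda>y. rsmult N y s) \<in> left_lin R N N"
  shows "right_module S T"
proof -
  interpret S: right_module S N by (fact S)
  note act = tensor_rsmult[OF lin]
  note actD = additive_homD[OF act(1)]
  have zero: "rsmult T \<zero>\<^bsub>T\<^esub> s = \<zero>\<^bsub>T\<^esub>" if "s \<in> carrier S" for s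
    using actD(3)[OF that] abelian_group_tensor by simp
  show ?thesis
  proof (intro right_module.intro right_module_axioms.intro S.S.ring_axioms abelian_group_tensor)
    show "rsmult T t s \<in> carrier T" if "t \<in> carrier T" "s \<in> carrier S" for s t
      using that by (intro actD(1))
    show "rsmult T (t \<oplus>\<^bsub>T\<^esub> u) s = rsmult T t s \<oplus>\<^bsub>T\<^esub> rsmult T u s"
      if "t \<in> carrier T" "u \<in> carrier T" "s \<in> carrier S" for s t u
      using that by (intro actD(2))
  next
    fix t r s assume t: "t \<in> carrier T" and r: "r \<in> carrier S" and s: "s \<in> carrier S"
    show "rsmult T t (r \<oplus>\<^bsub>S\<^esub> s) = rsmult T t r \<oplus>\<^bsub>T\<^esub> rsmult T t s"
      using t
      by (rule tensor_induct)
        (use r s in \<open>simp_all add: zero actD T.a_ac act(2) S.rsmult_add_right S.rsmult_closed pure_tensor_add_right\<close>)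
    show "rsmult T t (r \<otimes>\<^bsub>S\<^esub> s) = rsmult T (rsmult T t r) s"
      using t
      by (rule tensor_induct)
        (use r s in \<open>simp_all add: zero actD act(2) S.rsmult_assoc S.rsmult_closed\<close>)
  next
    fix t assume t: "t \<in> carrier T"
    show "rsmult T t \<one>\<^bsub>S\<^esub> = t"
      using t by (rule tensor_induct) (simp_all add: zero actD act(2) S.rsmult_one)
  qed
qed

end

section \<open>Right modules as left modules over the opposite ring\<close>

lemma right_linI:
  assumes "\<And>x. x \<in> carrier M \<Longrightarrow> f x \<in> carrier N"
    and "\<And>x y. \<lbrakk>x \<in> carrier M; y \<in> carrier M\<rbrakk> \<Longrightarrow> f (x \<oplus>\<^bsub>M\<^esub> y) = f x \<oplus>\<^bsub>N\<^esub> f y"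
    and "\<And>r x. \<lbrakk>r \<in> carrier S; x \<in> carrier M\<rbrakk> \<Longrightarrow> f (rsmult M x r) = rsmult N (f x) r"
  shows "f \<in> right_lin S M N"
  using assms unfolding right_lin_def by (auto intro!: homI)

lemma right_linD:
  assumes "f \<in> right_lin S M N"
  shows "x \<in> carrier M \<Longrightarrow> f x \<in> carrier N"
    and "\<lbrakk>x \<in> carrier M; y \<in> carrier M\<rbrakk> \<Longrightarrow> f (x \<oplus>\<^bsub>M\<^esub> y) = f x \<oplus>\<^bsub>N\<^esub> f y"
    and "\<lbrakk>r \<in> carrier S; x \<in> carrier M\<rbrakk> \<Longrightarrow> f (rsmult M x r) = rsmult N (f x) r"
  using assms unfolding right_lin_def hom_def by auto

text \<open>
  A right \<open>S\<close>-module is a left module over the opposite ring. Statements about left modules carry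
  over along this translation.
\<close>

definition opposite_ring :: "('a, 'b) ring_scheme \<Rightarrow> ('a, 'b) ring_scheme"
  where "opposite_ring R = R\<lparr>mult := \<lambda>x y. mult R y x\<rparr>"

text \<open>
  The two actions change places. The ring-theoretic fields, which carry no information about a module,
  are reset so that \<open>mirror\<close> commutes with direct powers on the nose.
\<close>

definition mirror :: "('l, 'r, 'm, 'a) bimodule_scheme \<Rightarrow> ('r, 'l, 'm) bimodule"
  where "mirror M =
    \<lparr>carrier = carrier M, mult = undefined, one = undefined, zero = zero M, add = add M,
     smult = (\<lambda>r x. rsmult M x r), rsmult = (\<lambda>x l. smult M l x)\<rparr>"

lemma opposite_ring_simps [simp]:
  "carrier (opposite_ring R) = carrier R"
  "mult (opposite_ring R) = (\<lambda>x y. mult R y x)"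
  "one (opposite_ring R) = one R"
  "zero (opposite_ring R) = zero R"
  "add (opposite_ring R) = add R"
  by (simp_all add: opposite_ring_def)

lemma mirror_simps [simp]:
  "carrier (mirror M) = carrier M"
  "zero (mirror M) = zero M"
  "add (mirror M) = add M"
  "smult (mirror M) = (\<lambda>r x. rsmult M x r)"
  "rsmult (mirror M) = (\<lambda>x l. smult M l x)"
  by (simp_all add: mirror_def)

lemma opposite_base_ring: "opposite_ring (base_ring A B) = base_ring (opposite_ring A) B"
  by (simp add: opposite_ring_def)

lemma ring_opposite:
  assumes "ring R" shows "ring (opposite_ring R)"
proof -
  interpret ring R by fact
  have "abelian_group (opposite_ring R)"
    by (intro abelian_groupI) (auto simp: a_ac intro: add.l_inv_ex)
  moreover have "monoid (opposite_ring R)"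
    by (intro monoidI) (simp_all add: m_assoc)
  ultimately show ?thesis
    by (intro ringI) (simp_all add: l_distr r_distr)
qed

lemma subring_opposite:
  assumes "ring R" "subring B R" shows "subring B (opposite_ring R)"
proof -
  have "\<ominus>\<^bsub>opposite_ring R\<^esub> x = \<ominus>\<^bsub>R\<^esub> x" for x
    by (simp add: a_inv_def)
  then show ?thesis
    using subringE[OF assms(2)]
    by (intro ring.subringI[OF ring_opposite[OF assms(1)]]) simp_all
qed

lemma left_module_mirror:
  assumes "right_module S M" shows "left_module (opposite_ring S) (mirror M)"
proof -
  interpret right_module S M by fact
  have "abelian_group (mirror M)"
    by (intro abelian_groupI) (auto simp: M.a_ac intro: M.add.l_inv_ex)
  then show ?thesis
    by (intro left_module.intro left_module_axioms.intro ring_opposite S.ring_axioms)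
      (simp_all add: rsmult_closed rsmult_add_left rsmult_add_right rsmult_assoc rsmult_one)
qed

lemma right_lin_eq_left_lin_mirror:
  "right_lin S M N = left_lin (opposite_ring S) (mirror M) (mirror N)"
  by (auto simp: right_lin_def left_lin_def hom_def)

lemma left_lin_eq_right_lin_mirror:
  "left_lin R M N = right_lin (opposite_ring R) (mirror M) (mirror N)"
  by (auto simp: right_lin_def left_lin_def hom_def)

lemma sub_bimodule_mirror:
  "sub_bimodule R S M P \<Longrightarrow> sub_bimodule (opposite_ring S) (opposite_ring R) (mirror M) P"
  by (auto simp: sub_bimodule_def subgroup_def m_inv_def)

lemma iso_to_direct_summand_mirror:
  assumes "iso_to_direct_summand R S M N"
  shows "iso_to_direct_summand (opposite_ring S) (opposite_ring R) (mirror M) (mirror N)"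
proof -
  obtain P Q f where "sub_bimodule R S N P" "sub_bimodule R S N Q"
    and sum: "P <+>\<^bsub>N\<^esub> Q = carrier N" "P \<inter> Q = {\<zero>\<^bsub>N\<^esub>}"
    and f: "f \<in> bimod_hom R S M (N\<lparr>carrier := P\<rparr>)" and bij: "bij_betw f (carrier M) P"
    using assms unfolding iso_to_direct_summand_def direct_summand_def by blast
  moreover have "mirror (N\<lparr>carrier := P\<rparr>) = mirror N\<lparr>carrier := P\<rparr>"
    by (simp add: mirror_def)
  then have "f \<in> bimod_hom (opposite_ring S) (opposite_ring R) (mirror M) (mirror N\<lparr>carrier := P\<rparr>)"
    using f unfolding bimod_hom_def right_lin_eq_left_lin_mirror[of S] left_lin_eq_right_lin_mirror[of R]
    by auto
  moreover have "P <+>\<^bsub>mirror N\<^esub> Q = P <+>\<^bsub>N\<^esub> Q"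
    by (simp add: set_add_def set_mult_def)
  ultimately have "direct_summand (opposite_ring S) (opposite_ring R) (mirror N) P"
    unfolding direct_summand_def by (auto intro!: exI[of _ Q] sub_bimodule_mirror)
  with bij \<open>f \<in> bimod_hom (opposite_ring S) (opposite_ring R) (mirror M) (mirror N\<lparr>carrier := P\<rparr>)\<close>
  show ?thesis unfolding iso_to_direct_summand_def by auto
qed

lemma mirror_direct_power_natural:
  "mirror (direct_power n (natural_bimodule A)) = direct_power n (natural_bimodule (opposite_ring A))"
  by (simp add: mirror_def direct_power_def)

lemma right_module_natural_subring:
  assumes "ring A" "subring B A"
  shows "right_module (base_ring A B) (natural_bimodule A)"
proof -
  interpret ring A by fact
  interpret N: left_module "base_ring A B" "natural_bimodule A"
    by (rule left_module_natural_subring[OF assms])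
  show ?thesis
    using subringE(1)[OF assms(2)]
    by (intro right_module.intro right_module_axioms.intro N.R.ring_axioms N.M.abelian_group_axioms)
      (auto simp: l_distr r_distr m_assoc subset_iff)
qed

lemma right_module_natural:
  assumes "ring A" shows "right_module A (natural_bimodule A)"
  using right_module_natural_subring[OF assms ring.carrier_is_subring[OF assms]] by simp

section \<open>Split depth two extensions\<close>

text \<open>
  This is the form in which the depth two condition enters, with \<open>M\<close> the tensor square.
\<close>

lemma summand_of_power_finite_rank:
  assumes R: "ring R" and M: "left_module R M"
    and iso: "iso_to_direct_summand R S M (direct_power n (natural_bimodule R))"
  shows "finite_rank R M M (\<lambda>x. x)"
proof -
  obtain f g where fg: "f \<in> left_lin R M (direct_power n (natural_bimodule R))"
    "g \<in> left_lin R (direct_power n (natural_bimodule R)) M" "\<And>x. x \<in> carrier M \<Longrightarrow> g (f x) = x"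
    using iso_to_direct_summand_retract[OF M left_module_direct_power[OF left_module_natural[OF R]] iso] by blast
  show ?thesis
    by (rule finite_rank_cong[OF retract_of_power_finite_rank[OF R M fg(1,2)]]) (simp add: fg(3))
qed

context
  fixes A :: "('a, 'b) ring_scheme" and B :: "'a set" and p :: "'a \<Rightarrow> 'a"
  assumes A: "ring A" and B: "subring B A"
    and p: "p \<in> bimod_hom (base_ring A B) (base_ring A B)
      (natural_bimodule A) (natural_bimodule (base_ring A B))"
    and p_one: "p \<one>\<^bsub>A\<^esub> = \<one>\<^bsub>A\<^esub>"
begin

interpretation A: ring A by (fact A)

private abbreviation (input) "S \<equiv> base_ring A B"
private abbreviation (input) "N \<equiv> natural_bimodule A"
private abbreviation (input) "AA \<equiv> tensor_square A B"
private abbreviation (input) "tens \<equiv> pure_tensor S N N"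

private lemma BA: "b \<in> B \<Longrightarrow> b \<in> carrier A"
  using subringE(1)[OF B] by blast

private lemma pD:
  "x \<in> carrier A \<Longrightarrow> p x \<in> B"
  "\<lbrakk>x \<in> carrier A; y \<in> carrier A\<rbrakk> \<Longrightarrow> p (x \<oplus>\<^bsub>A\<^esub> y) = p x \<oplus>\<^bsub>A\<^esub> p y"
  "\<lbrakk>b \<in> B; x \<in> carrier A\<rbrakk> \<Longrightarrow> p (b \<otimes>\<^bsub>A\<^esub> x) = b \<otimes>\<^bsub>A\<^esub> p x"
  "\<lbrakk>b \<in> B; x \<in> carrier A\<rbrakk> \<Longrightarrow> p (x \<otimes>\<^bsub>A\<^esub> b) = p x \<otimes>\<^bsub>A\<^esub> b"
  using p left_linD[of p S N "natural_bimodule S"] right_linD[of p S N "natural_bimodule S"]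
  unfolding bimod_hom_def by auto

private lemma rN: "right_module S N" by (rule right_module_natural_subring[OF A B])
private lemma lN: "left_module S N" by (rule left_module_natural_subring[OF A B])

private lemma left_mult_lin: "a \<in> carrier A \<Longrightarrow> smult N a \<in> right_lin S N N"
  by (intro right_linI) (auto simp: BA A.r_distr A.m_assoc)

private lemma right_mult_lin: "a \<in> carrier A \<Longrightarrow> (\<lambda>y. rsmult N y a) \<in> left_lin S N N"
  by (intro left_linI) (auto simp: BA A.l_distr A.m_assoc)

interpretation T: left_module A AA
  by (rule left_module_tensor[OF rN lN left_module_natural[OF A] left_mult_lin])

interpretation TR: right_module A AA
  by (rule right_module_tensor[OF rN lN right_module_natural[OF A] right_mult_lin])

private lemmas pure_closed = pure_tensor_closed[OF rN lN, simplified]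
  and pure_add_left = pure_tensor_add_left[OF rN lN, simplified]
  and pure_add_right = pure_tensor_add_right[OF rN lN, simplified]
  and pure_balanced = pure_tensor_balanced[OF rN lN, simplified]
  and smult_pure = tensor_smult(2)[OF rN lN left_mult_lin, simplified]
  and rsmult_pure = tensor_rsmult(2)[OF rN lN right_mult_lin, simplified]

text \<open>
  The maps \<open>\<iota> y = 1 \<otimes> y\<close> and \<open>\<Phi> (x \<otimes> y) = p(x) y\<close> satisfy \<open>\<Phi> (\<iota> y) = y\<close>; the second is balanced because
  \<open>p(x b) = p(x) b\<close>. For a pure tensor, \<open>a \<mapsto> \<Phi> (a (x \<otimes> y)) = p(a x) y\<close> has rank at most one over \<open>B\<close>, since
  \<open>a \<mapsto> p(a x)\<close> is a \<open>B\<close>-linear form. Descent from the identity of the tensor square applies.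
\<close>

lemma right_D2_split_finite_rank:
  assumes "right_D2 A B"
  shows "finite_rank (base_ring A B) (natural_bimodule A) (natural_bimodule A) (\<lambda>x. x)"
proof -
  obtain n where "iso_to_direct_summand A S AA (direct_power n N)"
    using assms unfolding right_D2_def by blast
  then have idT: "finite_rank A AA AA (\<lambda>t. t)"
    by (rule summand_of_power_finite_rank[OF A T.left_module_axioms])
  obtain \<Phi> where \<Phi>: "\<Phi> \<in> hom (add_monoid AA) (add_monoid N)"
    and \<Phi>_pure: "\<And>x y. \<lbrakk>x \<in> carrier A; y \<in> carrier A\<rbrakk> \<Longrightarrow> \<Phi> (tens x y) = p x \<otimes>\<^bsub>A\<^esub> y"
    by (rule tensor_universal[OF rN lN, of N "\<lambda>x y. p x \<otimes>\<^bsub>A\<^esub> y"])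
      (auto simp: pD BA A.l_distr A.r_distr A.m_assoc left_module.axioms(2)[OF lN])
  note \<Phi>D = additive_homD[OF \<Phi>]
  have \<Phi>_zero: "\<Phi> \<zero>\<^bsub>AA\<^esub> = \<zero>\<^bsub>A\<^esub>"
    using \<Phi>D(3)[OF T.abelian_group_axioms left_module.axioms(2)[OF lN]] by simp
  have \<iota>: "tens \<one>\<^bsub>A\<^esub> \<in> left_lin S N AA"
  proof (rule left_linI)
    fix b y assume "b \<in> carrier S" "y \<in> carrier N"
    then show "tens \<one>\<^bsub>A\<^esub> (smult N b y) = smult AA b (tens \<one>\<^bsub>A\<^esub> y)"
      using pure_balanced[of "\<one>\<^bsub>A\<^esub>" b y] smult_pure[of b "\<one>\<^bsub>A\<^esub>" y] BA by simp
  qed (simp_all add: pure_closed pure_add_right)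
  have rank: "finite_rank S N N (\<lambda>a. \<Phi> (smult AA a t))" if "t \<in> carrier AA" for t
    using rN lN that
  proof (rule tensor_induct)
    show "finite_rank S N N (\<lambda>a. \<Phi> (smult AA a \<zero>\<^bsub>AA\<^esub>))"
      by (rule finite_rank.zero) (simp add: \<Phi>_zero)
  next
    fix t u assume t: "t \<in> carrier AA" and u: "u \<in> carrier AA"
      and rank: "finite_rank S N N (\<lambda>a. \<Phi> (smult AA a t))" "finite_rank S N N (\<lambda>a. \<Phi> (smult AA a u))"
    show "finite_rank S N N (\<lambda>a. \<Phi> (smult AA a (t \<oplus>\<^bsub>AA\<^esub> u)))"
      by (rule finite_rank_cong[OF finite_rank_add[OF lN rank]])
        (use t u in \<open>simp add: T.smult_add_right T.smult_closed \<Phi>D(2)\<close>)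
  next
    fix x y assume x: "x \<in> carrier N" and y: "y \<in> carrier N"
    have "(\<lambda>a. p (a \<otimes>\<^bsub>A\<^esub> x)) \<in> left_lin S N (natural_bimodule S)"
      using x by (intro left_linI) (auto simp: pD BA A.l_distr A.m_assoc)
    then show "finite_rank S N N (\<lambda>a. \<Phi> (smult AA a (tens x y)))"
      using y by (rule finite_rank_single[OF lN]) (use x y in \<open>simp add: smult_pure \<Phi>_pure\<close>)
  qed
  show ?thesis
    by (rule finite_rank_cong[OF finite_rank_descent[OF A B T.left_module_axioms lN \<iota> \<Phi> rank idT]])
      (simp_all add: \<Phi>_pure p_one)
qed

text \<open>
  The mirror image, with \<open>\<iota> x = x \<otimes> 1\<close> and \<open>\<Phi> (x \<otimes> y) = x p(y)\<close>. Only modules are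
  mirrored here: the left module obtained from the tensor square need not be identified with the tensor
  square of the opposite ring, because descent accepts any module with suitable \<open>\<iota>\<close> and \<open>\<Phi>\<close>.
\<close>

lemma left_D2_split_finite_rank:
  assumes "left_D2 A B"
  shows "finite_rank (opposite_ring (base_ring A B))
    (mirror (natural_bimodule A)) (mirror (natural_bimodule A)) (\<lambda>x. x)"
proof -
  let ?A = "opposite_ring A" and ?N = "mirror N" and ?AA = "mirror AA"
  let ?S = "base_ring ?A B"
  note A' = ring_opposite[OF A] and B' = subring_opposite[OF A B]
  have lT: "left_module ?A ?AA" by (rule left_module_mirror[OF TR.right_module_axioms])
  have lN': "left_module ?S ?N"
    using left_module_mirror[OF rN] by (simp add: opposite_base_ring)
  note agN = left_module.axioms(2)[OF lN'] and agT = left_module.axioms(2)[OF lT]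
  obtain n where "iso_to_direct_summand S A AA (direct_power n N)"
    using assms unfolding left_D2_def by blast
  then have "iso_to_direct_summand ?A (opposite_ring S) ?AA (direct_power n (natural_bimodule ?A))"
    using iso_to_direct_summand_mirror by (simp only: flip: mirror_direct_power_natural)
  then have idT: "finite_rank ?A ?AA ?AA (\<lambda>t. t)"
    by (rule summand_of_power_finite_rank[OF A' lT])
  obtain \<Phi> where \<Phi>: "\<Phi> \<in> hom (add_monoid AA) (add_monoid ?N)"
    and \<Phi>_pure: "\<And>x y. \<lbrakk>x \<in> carrier A; y \<in> carrier A\<rbrakk> \<Longrightarrow> \<Phi> (tens x y) = x \<otimes>\<^bsub>A\<^esub> p y"
    by (rule tensor_universal[OF rN lN, of ?N "\<lambda>x y. x \<otimes>\<^bsub>A\<^esub> p y"])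
      (auto simp: pD BA A.l_distr A.r_distr A.m_assoc agN)
  have \<Phi>': "\<Phi> \<in> hom (add_monoid ?AA) (add_monoid ?N)"
    using \<Phi> by (simp add: hom_def)
  note \<Phi>D = additive_homD[OF \<Phi>', simplified]
  have \<Phi>_zero: "\<Phi> \<zero>\<^bsub>AA\<^esub> = \<zero>\<^bsub>A\<^esub>"
    using \<Phi>D(3)[OF agT agN] by simp
  have \<iota>: "(\<lambda>x. tens x \<one>\<^bsub>A\<^esub>) \<in> left_lin ?S ?N ?AA"
  proof (rule left_linI)
    fix b x assume "b \<in> carrier ?S" "x \<in> carrier ?N"
    then show "tens (smult ?N b x) \<one>\<^bsub>A\<^esub> = smult ?AA b (tens x \<one>\<^bsub>A\<^esub>)"
      using pure_balanced[of x b "\<one>\<^bsub>A\<^esub>"] rsmult_pure[of b x "\<one>\<^bsub>A\<^esub>"] BA by simp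
  qed (simp_all add: pure_closed pure_add_left)
  let ?rank = "\<lambda>t. finite_rank ?S (natural_bimodule ?A) ?N (\<lambda>a. \<Phi> (rsmult AA t a))"
  have rank: "?rank t" if "t \<in> carrier AA" for t
    using rN lN that
  proof (rule tensor_induct)
    have "rsmult AA \<zero>\<^bsub>AA\<^esub> a = \<zero>\<^bsub>AA\<^esub>" if "a \<in> carrier A" for a
      using left_module.smult_zero_right[OF lT, of a] that by simp
    then show "?rank \<zero>\<^bsub>AA\<^esub>"
      by (intro finite_rank.zero) (simp add: \<Phi>_zero)
  next
    fix t u assume t: "t \<in> carrier AA" and u: "u \<in> carrier AA" and rank: "?rank t" "?rank u"
    show "?rank (t \<oplus>\<^bsub>AA\<^esub> u)"
      by (rule finite_rank_cong[OF finite_rank_add[OF lN' rank]])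
        (use t u in \<open>simp add: TR.rsmult_add_left TR.rsmult_closed \<Phi>D(2)\<close>)
  next
    fix x y assume x: "x \<in> carrier N" and y: "y \<in> carrier N"
    have "(\<lambda>a. p (y \<otimes>\<^bsub>A\<^esub> a)) \<in> left_lin ?S (natural_bimodule ?A) (natural_bimodule ?S)"
      using y by (intro left_linI) (auto simp: pD BA A.r_distr simp flip: A.m_assoc)
    then show "?rank (tens x y)"
      by (rule finite_rank_single[OF lN', where u = x]) (use x y in \<open>simp_all add: rsmult_pure \<Phi>_pure\<close>)
  qed
  have "finite_rank ?S ?N ?N (\<lambda>x. \<Phi> (tens x \<one>\<^bsub>A\<^esub>))"
    by (rule finite_rank_descent[OF A' B' lT lN' \<iota> \<Phi>' _ idT]) (simp add: rank)
  then have "finite_rank ?S ?N ?N (\<lambda>x. x)"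
    by (rule finite_rank_cong) (simp_all add: \<Phi>_pure p_one)
  then show ?thesis by (simp add: opposite_base_ring)
qed

end

lemma finite_rank_id_imp_projective_left:
  assumes P: "left_module R P" and id: "finite_rank R P P (\<lambda>x. x)"
  shows "projective_left TYPE('m) TYPE('n) R P"
  unfolding projective_left_def
  using finite_rank_lift[OF _ _ P id _ _ _ P] P by blast

lemma finite_rank_id_imp_projective_right:
  fixes S :: "('r, 'a) ring_scheme" and P :: "('l, 'r, 'p, 'b) bimodule_scheme"
  assumes P: "right_module S P"
    and id: "finite_rank (opposite_ring S) (mirror P) (mirror P) (\<lambda>x. x)"
  shows "projective_right TYPE('m) TYPE('n) S P"
  unfolding projective_right_def
proof (intro conjI allI impI P; elim conjE)
  fix M :: "(unit, 'r, 'm) bimodule" and N :: "(unit, 'r, 'n) bimodule" and g f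
  assume M: "right_module S M" and N: "right_module S N"
    and "g \<in> right_lin S M N" "g ` carrier M = carrier N" "f \<in> right_lin S P N"
  then show "\<exists>h\<in>right_lin S P M. \<forall>x\<in>carrier P. g (h x) = f x"
    using finite_rank_lift[OF left_module_mirror[OF M] left_module_mirror[OF N]
        left_module_mirror[OF P] id, of g f] left_module_mirror[OF P]
    by (simp add: right_lin_eq_left_lin_mirror)
qed

lemma finite_rank_id_imp_finitely_generated_left:
  assumes "left_module R P" "finite_rank R P P (\<lambda>x. x)"
  shows "finitely_generated_left R P"
  unfolding finitely_generated_left_def
  using finite_rank_imp_spanned[OF assms] .

lemma finite_rank_id_imp_finitely_generated_right:
  fixes P :: "('l, 'r, 'p, 'b) bimodule_scheme"
  assumes "right_module S P" "finite_rank (opposite_ring S) (mirror P) (mirror P) (\<lambda>x. x)"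
  shows "finitely_generated_right S P"
proof -
  have "finsum (mirror P) f X = finsum P f X" for f :: "'p \<Rightarrow> 'p" and X
    by (simp add: finsum_def finprod_def)
  then show ?thesis
    unfolding finitely_generated_right_def
    using finite_rank_imp_spanned[OF left_module_mirror[OF assms(1)] assms(2)] by simp
qed

theorem proposition3p3:
  fixes A :: "('a, 'b) ring_scheme" and B :: "'a set"
  assumes "ring_extension A B"
    and "split_extension A B"
    and "D2 A B"
  shows "finitely_generated_right (base_ring A B) (natural_bimodule A) \<and>
      projective_right TYPE('m) TYPE('n) (base_ring A B) (natural_bimodule A) \<and>
      finitely_generated_left (base_ring A B) (natural_bimodule A) \<and>
      projective_left TYPE('m) TYPE('n) (base_ring A B) (natural_bimodule A)"
proof -
  have A: "ring A" and B: "subring B A"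
    using assms(1) by (simp_all add: ring_extension_def)
  obtain p where p: "p \<in> bimod_hom (base_ring A B) (base_ring A B)
      (natural_bimodule A) (natural_bimodule (base_ring A B))" and "\<And>b. b \<in> B \<Longrightarrow> p b = b"
    using assms(2) unfolding split_extension_def split_bimod_mono_def by auto
  then have p_one: "p \<one>\<^bsub>A\<^esub> = \<one>\<^bsub>A\<^esub>"
    using subringE(3)[OF B] by blast
  note right = right_module_natural_subring[OF A B] left_D2_split_finite_rank[OF A B p p_one]
  note left = left_module_natural_subring[OF A B] right_D2_split_finite_rank[OF A B p p_one]
  show ?thesis
    using assms(3) unfolding D2_def
    by (intro conjI finite_rank_id_imp_finitely_generated_right finite_rank_id_imp_projective_right
        finite_rank_id_imp_finitely_generated_left finite_rank_id_imp_projective_left right left)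
      blast+
qed

end
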